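(* Let $T$ be a complete theory. If $\varphi(x,y)$ witnesses SOP$_1$, then there exists a $\beta$-indiscernible tree $\langle e_\eta\rangle_{\eta\in{}^{\omega>}2}$ (in a monster model of $T$) which witnesses SOP$_1$ with $\varphi$.
   Context: ${}^{\omega>}2$ is the binary tree of finite $0/1$-sequences with initial-segment order $\trianglelefteq$, meet $\wedge$ and concatenation $^\frown$. $\varphi(x,y)$ witnesses SOP$_1$ with $\langle a_\eta\rangle_{\eta\in{}^{\omega>}2}$ if (i) for all $\eta\in{}^\omega2$, $\{\varphi(x,a_{\eta\lceil n}):n<\omega\}$ is consistent, and (ii) for all $\eta,\nu\in{}^{\omega>}2$, $\{\varphi(x,a_{\eta^\frown\langle1\rangle}),\varphi(x,a_{\eta^\frown\langle0\rangle^\frown\nu})\}$ is inconsistent. For tuples $\bar\eta=\langle\eta_0,\dots,\eta_n\rangle$, $\bar\nu=\langle\nu_0,\dots,\nu_n\rangle$ in ${}^{\omega>}2$, $\bar\eta\approx_\beta\bar\nu$ means: (i) the sets of entries of $\bar\eta$ and of $\bar\nu$ are closed under $\wedge$; (ii) $\eta_i\trianglelefteq\eta_j\iff\nu_i\trianglelefteq\nu_j$; (iii) $\eta_i^\frown\langle d\rangle\trianglelefteq\eta_j\iff\nu_i^\frown\langle d\rangle\trianglelefteq\nu_j$ for $d\le1$; (iv) $\eta_i^\frown\langle1\rangle=\eta_j\iff\nu_i^\frown\langle1\rangle=\nu_j$ — for all $i,j\le n$. A tree $\langle e_\eta\rangle$ is $\beta$-indiscernible if $\bar\eta\approx_\beta\bar\nu$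 implies $\langle e_{\eta_0},\dots,e_{\eta_n}\rangle\equiv\langle e_{\nu_0},\dots,e_{\nu_n}\rangle$. *)

theory Defs
  imports Main "HOL-Library.Sublist"
begin

datatype 'f trm = Var nat | Fn 'f "'f trm list"

datatype ('f, 'r) fml =
    Eq "'f trm" "'f trm"
  | Rel 'r "'f trm list"
  | Neg "('f, 'r) fml"
  | Conj "('f, 'r) fml" "('f, 'r) fml"
  | Ex nat "('f, 'r) fml"

fun fv_trm :: "'f trm \<Rightarrow> nat set" where
  "fv_trm (Var i) = {i}"
| "fv_trm (Fn f ts) = (\<Union>t\<in>set ts. fv_trm t)"

fun fv :: "('f, 'r) fml \<Rightarrow> nat set" where
  "fv (Eq s t) = fv_trm s \<union> fv_trm t"
| "fv (Rel r ts) = (\<Union>t\<in>set ts. fv_trm t)"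
| "fv (Neg p) = fv p"
| "fv (Conj p q) = fv p \<union> fv q"
| "fv (Ex i p) = fv p - {i}"

definition sentence :: "('f, 'r) fml \<Rightarrow> bool" where
  "sentence p \<longleftrightarrow> fv p = {}"

record ('a, 'f, 'r) struct =
  univ :: "'a set"
  fn_int :: "'f \<Rightarrow> 'a list \<Rightarrow> 'a"
  rel_int :: "'r \<Rightarrow> 'a list \<Rightarrow> bool"

definition is_struct :: "('a, 'f, 'r) struct \<Rightarrow> bool" where
  "is_struct M \<longleftrightarrow> univ M \<noteq> {} \<and>
     (\<forall>f as. set as \<subseteq> univ M \<longrightarrow> fn_int M f as \<in> univ M)"

fun eval :: "('a, 'f, 'r) struct \<Rightarrow> (nat \<Rightarrow> 'a) \<Rightarrow> 'f trm \<Rightarrow> 'a" where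
  "eval M s (Var i) = s i"
| "eval M s (Fn f ts) = fn_int M f (map (eval M s) ts)"

fun sat :: "('a, 'f, 'r) struct \<Rightarrow> ('f, 'r) fml \<Rightarrow> (nat \<Rightarrow> 'a) \<Rightarrow> bool" where
  "sat M (Eq t u) s \<longleftrightarrow> eval M s t = eval M s u"
| "sat M (Rel r ts) s \<longleftrightarrow> rel_int M r (map (eval M s) ts)"
| "sat M (Neg p) s \<longleftrightarrow> \<not> sat M p s"
| "sat M (Conj p q) s \<longleftrightarrow> sat M p s \<and> sat M q s"
| "sat M (Ex i p) s \<longleftrightarrow> (\<exists>b\<in>univ M. sat M p (s(i := b)))"

definition is_model :: "('a, 'f, 'r) struct \<Rightarrow> ('f, 'r) fml set \<Rightarrow> bool" where
  "is_model M T \<longleftrightarrow> is_struct M \<and>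
     (\<forall>\<sigma>\<in>T. \<forall>s. range s \<subseteq> univ M \<longrightarrow> sat M \<sigma> s)"

text \<open>A complete theory: a set of sentences containing, for every sentence, it or its negation.
  (Consistency is provided by the model in the theorem.)\<close>
definition complete_theory :: "('f, 'r) fml set \<Rightarrow> bool" where
  "complete_theory T \<longleftrightarrow> (\<forall>\<sigma>\<in>T. sentence \<sigma>) \<and>
     (\<forall>\<sigma>. sentence \<sigma> \<longrightarrow> \<sigma> \<in> T \<or> Neg \<sigma> \<in> T)"

text \<open>Monster-model requirement: aleph_1-saturation. Variable 0 is the unknown; all other
  variables are interpreted by a parameter sequence s (so countably many parameters).\<close>
definition aleph1_saturated :: "('a, 'f, 'r) struct \<Rightarrow> bool" where
  "aleph1_saturated M \<longleftrightarrow>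
    (\<forall>(\<Sigma> :: ('f, 'r) fml set) s. range s \<subseteq> univ M \<longrightarrow>
       (\<forall>\<Sigma>0. finite \<Sigma>0 \<and> \<Sigma>0 \<subseteq> \<Sigma> \<longrightarrow> (\<exists>b\<in>univ M. \<forall>\<psi>\<in>\<Sigma>0. sat M \<psi> (s(0 := b)))) \<longrightarrow>
       (\<exists>b\<in>univ M. \<forall>\<psi>\<in>\<Sigma>. sat M \<psi> (s(0 := b))))"

section \<open>Formulas \<phi>(x,y): x = variables 0..<k, y = variables k..<k+l\<close>

definition asg :: "nat \<Rightarrow> (nat \<Rightarrow> 'a) \<Rightarrow> (nat \<Rightarrow> 'a) \<Rightarrow> nat \<Rightarrow> 'a" where
  "asg k b a = (\<lambda>i. if i < k then b i else a (i - k))"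

text \<open>A set of instances \<psi>(x, a) (pairs of formula and parameter tuple) is consistent
  (with the elementary diagram of M) iff it is finitely satisfiable in M by k-tuples.\<close>
definition consistent_in :: "('a, 'f, 'r) struct \<Rightarrow> nat \<Rightarrow> (('f, 'r) fml \<times> (nat \<Rightarrow> 'a)) set \<Rightarrow> bool" where
  "consistent_in M k \<Gamma> \<longleftrightarrow>
    (\<forall>\<Gamma>0. finite \<Gamma>0 \<and> \<Gamma>0 \<subseteq> \<Gamma> \<longrightarrow>
       (\<exists>b. (\<forall>i<k. b i \<in> univ M) \<and> (\<forall>(\<psi>, a)\<in>\<Gamma>0. sat M \<psi> (asg k b a))))"

section \<open>The binary tree: 0/1 sequences as bool lists (False = 0, True = 1)\<close>

definition restr :: "(nat \<Rightarrow> bool) \<Rightarrow> nat \<Rightarrow> bool list" where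
  "restr \<eta> n = map \<eta> [0..<n]"

definition tree_in :: "('a, 'f, 'r) struct \<Rightarrow> nat \<Rightarrow> (bool list \<Rightarrow> nat \<Rightarrow> 'a) \<Rightarrow> bool" where
  "tree_in M l a \<longleftrightarrow> (\<forall>\<eta>. \<forall>i<l. a \<eta> i \<in> univ M)"

definition witnesses_SOP1 ::
  "('a, 'f, 'r) struct \<Rightarrow> nat \<Rightarrow> nat \<Rightarrow> ('f, 'r) fml \<Rightarrow> (bool list \<Rightarrow> nat \<Rightarrow> 'a) \<Rightarrow> bool" where
  "witnesses_SOP1 M k l \<phi> a \<longleftrightarrow> tree_in M l a \<and>
    (\<forall>\<eta> :: nat \<Rightarrow> bool. consistent_in M k {(\<phi>, a (restr \<eta> n)) | n. True}) \<and>
    (\<forall>\<eta> \<nu>. \<not> consistent_in M k {(\<phi>, a (\<eta> @ [True])), (\<phi>, a (\<eta> @ [False] @ \<nu>))})"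

text \<open>Tuples \<langle>\<eta>_0,...,\<eta>_n\<rangle> are functions on indices i \<le> n.\<close>
definition meet_closed :: "nat \<Rightarrow> (nat \<Rightarrow> bool list) \<Rightarrow> bool" where
  "meet_closed n \<eta> \<longleftrightarrow>
    (\<forall>i\<le>n. \<forall>j\<le>n. \<exists>m\<le>n. longest_common_prefix (\<eta> i) (\<eta> j) = \<eta> m)"

definition approx_beta :: "nat \<Rightarrow> (nat \<Rightarrow> bool list) \<Rightarrow> (nat \<Rightarrow> bool list) \<Rightarrow> bool" where
  "approx_beta n \<eta> \<nu> \<longleftrightarrow> meet_closed n \<eta> \<and> meet_closed n \<nu> \<and>
    (\<forall>i\<le>n. \<forall>j\<le>n.
       (prefix (\<eta> i) (\<eta> j) \<longleftrightarrow> prefix (\<nu> i) (\<nu> j)) \<and>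
       (\<forall>d. prefix (\<eta> i @ [d]) (\<eta> j) \<longleftrightarrow> prefix (\<nu> i @ [d]) (\<nu> j)) \<and>
       (\<eta> i @ [True] = \<eta> j \<longleftrightarrow> \<nu> i @ [True] = \<nu> j))"

text \<open>Equality of types (in M) of the concatenated tuples e_{\<eta>_0}...e_{\<eta>_n} and
  e_{\<nu>_0}...e_{\<nu>_n}: variable m denotes coordinate (m mod l) of entry (m div l).\<close>
definition same_type ::
  "('a, 'f, 'r) struct \<Rightarrow> nat \<Rightarrow> nat \<Rightarrow> (bool list \<Rightarrow> nat \<Rightarrow> 'a) \<Rightarrow> (nat \<Rightarrow> bool list) \<Rightarrow> (nat \<Rightarrow> bool list) \<Rightarrow> bool" where
  "same_type M l n e \<eta> \<nu> \<longleftrightarrow>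
    (\<forall>\<psi> :: ('f, 'r) fml. fv \<psi> \<subseteq> {..<(Suc n) * l} \<longrightarrow>
       (sat M \<psi> (\<lambda>m. e (\<eta> (m div l)) (m mod l)) \<longleftrightarrow> sat M \<psi> (\<lambda>m. e (\<nu> (m div l)) (m mod l))))"

definition beta_indiscernible :: "('a, 'f, 'r) struct \<Rightarrow> nat \<Rightarrow> (bool list \<Rightarrow> nat \<Rightarrow> 'a) \<Rightarrow> bool" where
  "beta_indiscernible M l e \<longleftrightarrow>
    (\<forall>n \<eta> \<nu>. approx_beta n \<eta> \<nu> \<longrightarrow> same_type M l n e \<eta> \<nu>)"

end

theory Submission
  imports Defs "HOL-Analysis.Function_Topology" "HOL-Library.Tree" "HOL-Library.Countable"
begin

text \<open>Given a tree \<open>a\<close> witnessing SOP1, put \<open>d\<^sub>\<mu> = a\<^bsub>\<mu>1\<^esub>\<close>. Then \<open>{\<phi>(x, d\<^sub>\<mu>), \<phi>(x, d\<^bsub>\<mu>0\<nu>\<^esub>)}\<close> is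
  inconsistent and the instances at those nodes of a branch where the branch turns to 1 are
  consistent together. Both properties survive every map \<open>g\<close> of the tree such that
  \<open>\<rho>d \<unlhd> \<nu>\<close> implies \<open>g(\<rho>)d \<unlhd> g(\<nu>)\<close>.

  Choose ultrafilters \<open>p\<^sub>0, p\<^sub>1\<close> on words with \<open>p\<^sub>i\<close> concentrated on words beginning with \<open>i\<close> and
  \<open>p\<^sub>i p\<^sub>j = p\<^sub>i\<close>. Building \<open>g\<close> in preorder, with \<open>g(\<nu>i)\<close> obtained from \<open>g(\<nu>)\<close> by appending a
  \<open>p\<^sub>i\<close>-generic word, makes the truth value of a formula at a meet-closed tuple depend only on the
  tuple's meets and directions, because by absorption the nodes omitted by the tuple leave no trace.
  By saturation these truth values are realised by a tree \<open>c\<close>, which is indiscernible for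
  similarity of meets and directions.

  Finally let \<open>h\<close> replace every 0 by 10 in a word and set \<open>e\<^sub>\<eta> = c\<^bsub>h(\<eta>)\<^esub>\<close>. Every step of a branch
  now turns to 1 first, so branches are consistent, while \<open>h(\<eta>1)0 \<unlhd> h(\<eta>0\<nu>)\<close> gives the required
  inconsistencies. The shape of \<open>h(\<eta>)\<close> for a tuple is determined by its \<open>\<beta>\<close>-type.\<close>

section \<open>Ultrafilters on words\<close>

text \<open>Ultrafilters will be points of a function space with the product topology. The Hausdorff
  property makes compact sets and equalisers of continuous maps closed there.\<close>

instance "fun" :: (type, t2_space) t2_space
proof
  fix f g :: "'a \<Rightarrow> 'b" assume "f \<noteq> g"
  then obtain i where "f i \<noteq> g i" by auto
  then obtain U V where UV: "open U" "open V" "f i \<in> U" "g i \<in> V" "U \<inter> V = {}"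
    by (metis hausdorff)
  define pre where "pre W = (\<lambda>h :: 'a \<Rightarrow> 'b. h i) -` W" for W
  have pre: "open (pre W)" if "open W" for W
    unfolding pre_def using that by (rule open_vimage) simp
  show "\<exists>U V. open U \<and> open V \<and> f \<in> U \<and> g \<in> V \<and> U \<inter> V = {}"
  proof (intro exI conjI)
    show "open (pre U)" "open (pre V)" using pre UV by blast+
    show "f \<in> pre U" "g \<in> pre V" "pre U \<inter> pre V = {}" using UV unfolding pre_def by auto
  qed
qed

text \<open>Zorn's lemma for reverse inclusion: compactness keeps the intersection of a chain of
  nonempty closed sets nonempty. \<open>Q\<close> will express being a subsemigroup or a left
  ideal.\<close>

lemma ex_minimal_closed_subset:
  fixes X :: "'a::topological_space set"
  assumes "compact X" "closed X" "X \<noteq> {}" "Q X"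
    and Q: "\<And>C. C \<noteq> {} \<Longrightarrow> (\<And>Y. Y \<in> C \<Longrightarrow> Q Y) \<Longrightarrow> Q (\<Inter>C)"
  shows "\<exists>Y\<subseteq>X. closed Y \<and> Y \<noteq> {} \<and> Q Y \<and> (\<forall>Z\<subseteq>Y. closed Z \<and> Z \<noteq> {} \<and> Q Z \<longrightarrow> Z = Y)"
proof -
  \<comment> \<open>Complements turn minimal sets into the maximal ones that Zorn's lemma
    provides.\<close>
  define A where "A = {- Y |Y. Y \<subseteq> X \<and> closed Y \<and> Y \<noteq> {} \<and> Q Y}"
  have "\<exists>M\<in>A. \<forall>Z\<in>A. M \<subseteq> Z \<longrightarrow> Z = M"
  proof (rule subset_Zorn_nonempty)
    show "A \<noteq> {}" using assms unfolding A_def by blast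
    fix C assume C: "C \<noteq> {}" "subset.chain A C"
    define D where "D = uminus ` C"
    have D: "Y \<subseteq> X" "closed Y" "Y \<noteq> {}" "Q Y" if "Y \<in> D" for Y
      using that C unfolding D_def A_def subset.chain_def by auto
    have chain: "Y \<subseteq> Z \<or> Z \<subseteq> Y" if "Y \<in> D" "Z \<in> D" for Y Z
      using that C unfolding D_def subset_chain_def by blast
    have least: "\<exists>Y\<in>E. \<forall>Z\<in>E. Y \<subseteq> Z" if "finite E" "E \<noteq> {}" "E \<subseteq> D" for E
      using that
    proof (induction E rule: finite_ne_induct)
      case (insert Y E)
      then obtain Y' where Y': "Y' \<in> E" "\<forall>Z\<in>E. Y' \<subseteq> Z" by blast
      show ?case
      proof (cases "Y \<subseteq> Y'")
        case True
        then show ?thesis using Y' by blast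
      next
        case False
        then have "Y' \<subseteq> Y" using chain[of Y Y'] insert.prems Y' by blast
        then show ?thesis using Y' by blast
      qed
    qed simp
    have ne: "D \<noteq> {}" using C unfolding D_def by simp
    have "X \<inter> \<Inter>D \<noteq> {}"
    proof (rule compact_imp_fip[OF \<open>compact X\<close>])
      fix E assume E: "finite E" "E \<subseteq> D"
      show "X \<inter> \<Inter>E \<noteq> {}"
      proof (cases "E = {}")
        case False
        then obtain Y where Y: "Y \<in> E" "\<forall>Z\<in>E. Y \<subseteq> Z" using least[OF E(1) False E(2)] by blast
        then have "Y \<subseteq> X \<inter> \<Inter>E" "Y \<noteq> {}" using D E by blast+
        then show ?thesis by blast
      qed (use \<open>X \<noteq> {}\<close> in simp)
    qed (use D in blast)
    moreover have "\<Inter>D \<subseteq> X" using D ne by blast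
    moreover have "Q (\<Inter>D)" using Q ne D by blast
    moreover have "closed (\<Inter>D)" using D by blast
    moreover have "\<Union>C = - \<Inter>D" unfolding D_def by auto
    ultimately show "\<Union>C \<in> A" unfolding A_def by blast
  qed
  then obtain Y where "Y \<subseteq> X" "closed Y" "Y \<noteq> {}" "Q Y" and m: "\<forall>Z\<in>A. -Y \<subseteq> Z \<longrightarrow> Z = -Y"
    unfolding A_def by auto
  moreover have "Z = Y" if "Z \<subseteq> Y" "closed Z" "Z \<noteq> {}" "Q Z" for Z
  proof -
    have "-Z \<in> A" using that \<open>Y \<subseteq> X\<close> unfolding A_def by blast
    then show ?thesis using m that by blast
  qed
  ultimately show ?thesis by blast
qed

text \<open>The Ellis-Numakura lemma. In a minimal closed subsemigroup \<open>Y\<close> with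
  \<open>y \<in> Y\<close>, minimality gives first \<open>Y y = Y\<close>, so some \<open>z\<close>
  satisfies \<open>z y = y\<close>, and then that the closed subsemigroup of all such
  \<open>z\<close> is \<open>Y\<close> itself, so it contains \<open>y\<close>.\<close>

lemma right_topological_idempotent:
  fixes X :: "'a::t2_space set" and m :: "'a \<Rightarrow> 'a \<Rightarrow> 'a"
  assumes X: "compact X" "X \<noteq> {}"
    and cl: "\<And>p q. p \<in> X \<Longrightarrow> q \<in> X \<Longrightarrow> m p q \<in> X"
    and assoc: "\<And>p q r. m (m p q) r = m p (m q r)"
    and cont: "\<And>q. continuous_on UNIV (\<lambda>p. m p q)"
  shows "\<exists>e\<in>X. m e e = e"
proof -
  define Q where "Q Y \<longleftrightarrow> (\<forall>p\<in>Y. \<forall>q\<in>Y. m p q \<in> Y)" for Y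
  have "\<exists>Y\<subseteq>X. closed Y \<and> Y \<noteq> {} \<and> Q Y \<and> (\<forall>Z\<subseteq>Y. closed Z \<and> Z \<noteq> {} \<and> Q Z \<longrightarrow> Z = Y)"
    by (rule ex_minimal_closed_subset) (use X cl compact_imp_closed in \<open>auto simp: Q_def\<close>)
  then obtain Y where Y: "Y \<subseteq> X" "closed Y" "Y \<noteq> {}" "Q Y"
    and min: "\<And>Z. Z \<subseteq> Y \<Longrightarrow> closed Z \<Longrightarrow> Z \<noteq> {} \<Longrightarrow> Q Z \<Longrightarrow> Z = Y" by metis
  have "compact Y" using X Y by (metis closed_Int_compact inf.absorb1)
  obtain y where y: "y \<in> Y" using Y by blast
  have "compact ((\<lambda>p. m p y) ` Y)"
    using cont \<open>compact Y\<close> by (meson compact_continuous_image continuous_on_subset subset_UNIV)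
  moreover have "Q ((\<lambda>p. m p y) ` Y)"
    using Y y unfolding Q_def by (auto simp flip: assoc)
  ultimately have "(\<lambda>p. m p y) ` Y = Y"
    using min Y y compact_imp_closed unfolding Q_def by (metis image_is_empty image_subsetI)
  then obtain z where z: "z \<in> Y" "m z y = y" using y by (metis imageE)
  define Z where "Z = Y \<inter> {p. m p y = y}"
  have "closed {p. m p y = y}"
    using closed_Collect_eq[OF cont continuous_on_const] by simp
  then have "closed Z" unfolding Z_def using Y by blast
  moreover have "Q Z" using Y assoc unfolding Q_def Z_def by auto
  ultimately have "Z = Y" using min z unfolding Z_def by blast
  then show ?thesis using y Y unfolding Z_def by blast
qed

section \<open>The compact semigroup of ultrafilters\<close>

text \<open>In this form an ultrafilter acts as a quantifier "for almost all" that commutes with the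
  connectives, and the ultrafilters lie in a power of \<open>bool\<close>.\<close>

definition ultrafilter :: "(('a \<Rightarrow> bool) \<Rightarrow> bool) \<Rightarrow> bool" where
  "ultrafilter p \<longleftrightarrow> p (\<lambda>_. True) \<and> (\<forall>P. p (\<lambda>x. \<not> P x) \<longleftrightarrow> \<not> p P) \<and>
    (\<forall>P Q. p (\<lambda>x. P x \<and> Q x) \<longleftrightarrow> p P \<and> p Q)"

text \<open>The extension of concatenation to ultrafilters: a \<open>p\<close>-generic word is
  chosen first, and a \<open>q\<close>-generic word is appended to it.\<close>

definition uf_prod :: "(('a list \<Rightarrow> bool) \<Rightarrow> bool) \<Rightarrow> (('a list \<Rightarrow> bool) \<Rightarrow> bool) \<Rightarrow> ('a list \<Rightarrow> bool) \<Rightarrow> bool"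
  where "uf_prod p q P \<longleftrightarrow> p (\<lambda>u. q (\<lambda>v. P (u @ v)))"

lemma ultrafilter_True: "ultrafilter p \<Longrightarrow> p (\<lambda>_. True)"
  and ultrafilter_not: "ultrafilter p \<Longrightarrow> p (\<lambda>x. \<not> P x) \<longleftrightarrow> \<not> p P"
  and ultrafilter_conj: "ultrafilter p \<Longrightarrow> p (\<lambda>x. P x \<and> Q x) \<longleftrightarrow> p P \<and> p Q"
  unfolding ultrafilter_def by auto

lemma ultrafilter_const: "ultrafilter p \<Longrightarrow> p (\<lambda>_. c) \<longleftrightarrow> c"
  using ultrafilter_not[of p "\<lambda>_. True"] ultrafilter_True by (cases c) auto

lemma ultrafilter_mono:
  assumes "ultrafilter p" "p P" "\<And>x. P x \<Longrightarrow> Q x"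
  shows "p Q"
proof -
  have "(\<lambda>x. P x \<and> Q x) = P" using assms(3) by auto
  then show ?thesis using ultrafilter_conj[OF assms(1), of P Q] assms(2) by simp
qed

lemma ultrafilter_uf_prod: "ultrafilter p \<Longrightarrow> ultrafilter q \<Longrightarrow> ultrafilter (uf_prod p q)"
  unfolding ultrafilter_def uf_prod_def by simp

lemma uf_prod_assoc: "uf_prod (uf_prod p q) r = uf_prod p (uf_prod q r)"
  unfolding uf_prod_def by simp

text \<open>For fixed \<open>q\<close> and \<open>P\<close>, the value of the product is the value
  of \<open>p\<close> at one fixed predicate, that is, a projection.\<close>

lemma continuous_on_uf_prod: "continuous_on UNIV (\<lambda>p. uf_prod p q)"
proof (rule continuous_on_coordinatewise_then_product)
  fix P
  show "continuous_on UNIV (\<lambda>p. uf_prod p q P)"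
    unfolding uf_prod_def by simp
qed

text \<open>Tychonoff's theorem for a power of a finite space.\<close>

lemma compact_bool_fun: "compact (UNIV :: ('b \<Rightarrow> bool) set)"
proof -
  have "compact_space (euclidean :: bool topology)"
    by (simp add: finite_imp_compact compact_space_def)
  then have "compact_space (product_topology (\<lambda>_::'b. euclidean :: bool topology) UNIV)"
    by (simp add: compact_space_product_topology)
  then show ?thesis
    by (simp add: euclidean_product_topology compact_space_def)
qed

lemma closed_coordinate: "closed {p :: 'b \<Rightarrow> bool. p P}" "closed {p :: 'b \<Rightarrow> bool. \<not> p P}"
proof -
  have *: "closed {p :: 'b \<Rightarrow> bool. p P = c}" for c
    by (rule closed_Collect_eq) auto
  show "closed {p :: 'b \<Rightarrow> bool. p P}" "closed {p :: 'b \<Rightarrow> bool. \<not> p P}"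
    using *[of True] *[of False] by simp_all
qed

lemma closed_ultrafilters: "closed {p :: ('a \<Rightarrow> bool) \<Rightarrow> bool. ultrafilter p}"
proof -
  have "{p :: ('a \<Rightarrow> bool) \<Rightarrow> bool. ultrafilter p} =
    {p. p (\<lambda>_. True) \<and> (\<forall>P. p (\<lambda>x. \<not> P x) \<and> \<not> p P \<or> \<not> p (\<lambda>x. \<not> P x) \<and> p P) \<and>
      (\<forall>P Q. p (\<lambda>x. P x \<and> Q x) \<and> p P \<and> p Q \<or> \<not> p (\<lambda>x. P x \<and> Q x) \<and> (\<not> p P \<or> \<not> p Q))}"
    unfolding ultrafilter_def by (intro Collect_cong conj_cong refl iff_allI) auto
  also have "closed \<dots>"
    by (intro closed_Collect_conj closed_Collect_disj closed_Collect_all closed_coordinate)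
  finally show ?thesis .
qed

lemma ultrafilter_principal: "ultrafilter (\<lambda>P. P x)"
  unfolding ultrafilter_def by simp

text \<open>The filters are idempotents of one minimal left ideal of the semigroup of ultrafilters on
  words, where every idempotent is a right identity; \<open>p d\<close> is found by intersecting this left
  ideal with the closed right ideal of words beginning with \<open>d\<close>.\<close>
lemma ex_absorbing_ultrafilters:
  "\<exists>p :: 'a \<Rightarrow> ('a list \<Rightarrow> bool) \<Rightarrow> bool.
     (\<forall>d. ultrafilter (p d) \<and> p d (\<lambda>w. \<exists>v. w = d # v)) \<and> (\<forall>c d. uf_prod (p c) (p d) = p c)"
proof -
  define X :: "(('a list \<Rightarrow> bool) \<Rightarrow> bool) set" where "X = {p. ultrafilter p}"
  have X: "closed X" "compact X"
    using closed_ultrafilters compact_bool_fun closed_Int_compact[of X UNIV] unfolding X_def by auto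
  have Xprod: "uf_prod p q \<in> X" if "p \<in> X" "q \<in> X" for p q
    using that by (simp add: X_def ultrafilter_uf_prod)
  define Q where "Q L \<longleftrightarrow> (\<forall>p\<in>X. \<forall>q\<in>L. uf_prod p q \<in> L)" for L :: "(('a list \<Rightarrow> bool) \<Rightarrow> bool) set"
  have principal: "(\<lambda>P. P w) \<in> X" for w by (simp add: X_def ultrafilter_principal)
  then have "X \<noteq> {}" by auto
  have "\<exists>L\<subseteq>X. closed L \<and> L \<noteq> {} \<and> Q L \<and> (\<forall>Z\<subseteq>L. closed Z \<and> Z \<noteq> {} \<and> Q Z \<longrightarrow> Z = L)"
    by (rule ex_minimal_closed_subset) (use X \<open>X \<noteq> {}\<close> Xprod in \<open>auto simp: Q_def\<close>)
  then obtain L where L: "L \<subseteq> X" "closed L" "L \<noteq> {}" "Q L"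
    and min: "\<And>Z. Z \<subseteq> L \<Longrightarrow> closed Z \<Longrightarrow> Z \<noteq> {} \<Longrightarrow> Q Z \<Longrightarrow> Z = L" by metis
  \<comment> \<open>\<open>X q\<close> is a closed left ideal contained in \<open>L\<close>, so
    minimality forces equality.\<close>
  have Lgen: "(\<lambda>p. uf_prod p q) ` X = L" if q: "q \<in> L" for q
  proof (rule min)
    have "compact ((\<lambda>p. uf_prod p q) ` X)"
      by (rule compact_continuous_image[OF continuous_on_subset[OF continuous_on_uf_prod subset_UNIV] X(2)])
    then show "closed ((\<lambda>p. uf_prod p q) ` X)" by (rule compact_imp_closed)
    show "Q ((\<lambda>p. uf_prod p q) ` X)"
      unfolding Q_def using Xprod by (auto simp flip: uf_prod_assoc)
  qed (use L q \<open>X \<noteq> {}\<close> in \<open>auto simp: Q_def\<close>)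
  have "\<exists>e\<in>L \<inter> {p. p (\<lambda>w. \<exists>v. w = d # v)}. uf_prod e e = e" for d
  proof (rule right_topological_idempotent[where m = uf_prod])
    show "compact (L \<inter> {p. p (\<lambda>w. \<exists>v. w = d # v)})"
    proof (rule compact_Int_closed)
      show "compact L" using L X by (metis closed_Int_compact inf.absorb1)
      show "closed {p :: ('a list \<Rightarrow> bool) \<Rightarrow> bool. p (\<lambda>w. \<exists>v. w = d # v)}"
        by (rule closed_coordinate)
    qed
    \<comment> \<open>Left multiplication by the principal ultrafilter of the one-letter word
      \<open>[d]\<close> stays in \<open>L\<close> and forces the first letter
      \<open>d\<close>.\<close>
    obtain q where q: "q \<in> L" using L by blast
    then have "uf_prod (\<lambda>P. P [d]) q \<in> L"
      using L(4) principal[of "[d]"] unfolding Q_def by simp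
    moreover have "uf_prod (\<lambda>P. P [d]) q (\<lambda>w. \<exists>v. w = d # v)"
      using q L ultrafilter_True unfolding uf_prod_def X_def by auto
    ultimately show "L \<inter> {p. p (\<lambda>w. \<exists>v. w = d # v)} \<noteq> {}" by blast
    fix p q assume p: "p \<in> L \<inter> {p. p (\<lambda>w. \<exists>v. w = d # v)}" and q: "q \<in> L \<inter> {p. p (\<lambda>w. \<exists>v. w = d # v)}"
    have u: "ultrafilter p" "ultrafilter q" using p q L X_def by auto
    have "uf_prod p q (\<lambda>w. \<exists>v. w = d # v)"
      unfolding uf_prod_def
    proof (rule ultrafilter_mono[OF u(1)])
      show "p (\<lambda>w. \<exists>v. w = d # v)" using p by blast
      show "q (\<lambda>v. \<exists>va. w @ v = d # va)" if "\<exists>v. w = d # v" for w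
        using that ultrafilter_True[OF u(2)] by auto
    qed
    moreover have "uf_prod p q \<in> L" using p q L unfolding Q_def by blast
    ultimately show "uf_prod p q \<in> L \<inter> {p. p (\<lambda>w. \<exists>v. w = d # v)}" by blast
  qed (auto simp: uf_prod_assoc continuous_on_uf_prod)
  then have "\<forall>d. \<exists>e. e \<in> L \<and> e (\<lambda>w. \<exists>v. w = d # v) \<and> uf_prod e e = e" by auto
  from choice[OF this] obtain p where p: "\<And>d. p d \<in> L" "\<And>d. p d (\<lambda>w. \<exists>v. w = d # v)"
    "\<And>d. uf_prod (p d) (p d) = p d" by auto
  have "uf_prod (p c) (p d) = p c" for c d
  proof -
    \<comment> \<open>Since \<open>X (p d) = L\<close>, \<open>p c\<close> is a left multiple of
      \<open>p d\<close>; right multiplication by the idempotent \<open>p d\<close> fixes all such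
      multiples.\<close>
    have "p c \<in> (\<lambda>q. uf_prod q (p d)) ` X" unfolding Lgen[OF p(1)] by (rule p(1))
    then obtain q where "p c = uf_prod q (p d)" by auto
    then show ?thesis using p(3) by (simp add: uf_prod_assoc)
  qed
  moreover have "ultrafilter (p d)" for d using p(1)[of d] L(1) unfolding X_def by auto
  ultimately show ?thesis using p(2) by (intro exI[of _ p]) simp
qed

section \<open>Generic placements of trees\<close>

definition ignores :: "'i set \<Rightarrow> (('i \<Rightarrow> 'b) \<Rightarrow> bool) \<Rightarrow> bool" where
  "ignores Z K \<longleftrightarrow> (\<forall>g g'. (\<forall>i. i \<notin> Z \<longrightarrow> g i = g' i) \<longrightarrow> K g = K g')"

lemma ignoresI: "(\<And>g g'. (\<And>i. i \<notin> Z \<Longrightarrow> g i = g' i) \<Longrightarrow> K g = K g') \<Longrightarrow> ignores Z K"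
  and ignoresD: "ignores Z K \<Longrightarrow> (\<And>i. i \<notin> Z \<Longrightarrow> g i = g' i) \<Longrightarrow> K g = K g'"
  unfolding ignores_def by blast+

text \<open>By \<open>absorb\<close>, a generic word in direction \<open>c\<close> followed by one
  in direction \<open>d\<close> can be replaced by a single generic word in direction
  \<open>c\<close>: the first direction survives.\<close>

locale absorbing_ultrafilters =
  fixes p :: "bool \<Rightarrow> (bool list \<Rightarrow> bool) \<Rightarrow> bool"
  assumes uf: "ultrafilter (p d)"
    and starts: "p d (\<lambda>w. \<exists>v. w = d # v)"
    and absorb: "uf_prod (p c) (p d) = p c"
begin

text \<open>The labels of a tree are assigned nodes of the binary tree in preorder: the root goes to
  \<open>x @ w\<close> for a \<open>p d\<close>-generic word \<open>w\<close>, and the continuation of the left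
  subtree is the placement of the right one. In this order all the words between a label and its
  parent in a subtree are chosen consecutively, so skipped labels are absorbed.\<close>
primrec generic ::
  "'i tree \<Rightarrow> bool \<Rightarrow> bool list \<Rightarrow> (('i \<Rightarrow> bool list) \<Rightarrow> bool) \<Rightarrow> ('i \<Rightarrow> bool list) \<Rightarrow> bool" where
  "generic Leaf d x K g \<longleftrightarrow> K g"
| "generic (Node l i r) d x K g \<longleftrightarrow>
     p d (\<lambda>w. generic l False (x @ w) (generic r True (x @ w) K) (g(i := x @ w)))"

text \<open>With \<open>generic_conj\<close> and \<open>generic_const\<close>, this makes
  \<open>generic t d x\<close> an ultrafilter on placements. Hence the formulas that hold
  generically will form a complete and finitely satisfiable set.\<close>

lemma generic_not: "generic t d x (\<lambda>g. \<not> K g) g \<longleftrightarrow> \<not> generic t d x K g"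
proof (induction t arbitrary: d x K g)
  case (Node l i r)
  \<comment> \<open>An equation of functions, because this is the continuation handed to the left
    subtree.\<close>
  have "generic r e y (\<lambda>g. \<not> K g) = (\<lambda>g. \<not> generic r e y K g)" for e y
    using Node.IH(2) by blast
  then show ?case using Node.IH(1) by (simp add: ultrafilter_not[OF uf] fun_upd_def)
qed simp

lemma generic_conj: "generic t d x (\<lambda>g. K g \<and> L g) g \<longleftrightarrow> generic t d x K g \<and> generic t d x L g"
proof (induction t arbitrary: d x K L g)
  case (Node l i r)
  have "generic r e y (\<lambda>g. K g \<and> L g) = (\<lambda>g. generic r e y K g \<and> generic r e y L g)" for e y
    using Node.IH(2) by blast
  then show ?case using Node.IH(1) by (simp add: ultrafilter_conj[OF uf] fun_upd_def)
qed simp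

lemma generic_const: "generic t d x (\<lambda>_. c) g \<longleftrightarrow> c"
proof (induction t arbitrary: d x g)
  case (Node l i r)
  have "generic r e y (\<lambda>_. c) = (\<lambda>_. c)" for e y
    using Node.IH(2) by blast
  then show ?case using Node.IH(1) by (simp add: ultrafilter_const[OF uf] fun_upd_def)
qed simp

lemma generic_ball:
  assumes "finite A"
  shows "generic t d x (\<lambda>g. \<forall>a\<in>A. K a g) g \<longleftrightarrow> (\<forall>a\<in>A. generic t d x (K a) g)"
  using assms by induction (simp_all add: generic_const generic_conj)

lemma generic_imp_ex:
  assumes "generic t d x K g"
  shows "\<exists>g. K g"
proof (rule ccontr)
  assume "\<nexists>g. K g"
  then have "K = (\<lambda>_. False)" by auto
  then show False using assms generic_const[of t d x False] by simp
qed

text \<open>The possible outcomes when each word is only known to begin with its direction.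
  Geometric facts are proved for all such outcomes and transferred by
  \<open>generic_if_placed\<close>.\<close>

primrec placed ::
  "'i tree \<Rightarrow> bool \<Rightarrow> bool list \<Rightarrow> ('i \<Rightarrow> bool list) \<Rightarrow> ('i \<Rightarrow> bool list) \<Rightarrow> bool" where
  "placed Leaf d x g g' \<longleftrightarrow> g' = g"
| "placed (Node l i r) d x g g' \<longleftrightarrow>
     (\<exists>v g1. placed l False (x @ d # v) (g(i := x @ d # v)) g1 \<and> placed r True (x @ d # v) g1 g')"

lemma generic_if_placed: "(\<And>g'. placed t d x g g' \<Longrightarrow> K g') \<Longrightarrow> generic t d x K g"
proof (induction t arbitrary: d x K g)
  case (Node l i r)
  have *: "generic l False (x @ w) (generic r True (x @ w) K) (g(i := x @ w))" if w: "\<exists>v. w = d # v" for w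
  proof -
    obtain v where "w = d # v" using w by blast
    show ?thesis
    proof (intro Node.IH)
      fix g1 g2
      assume "placed l False (x @ w) (g(i := x @ w)) g1" "placed r True (x @ w) g1 g2"
      then show "K g2" using \<open>w = d # v\<close> by (intro Node.prems) auto
    qed
  qed
  show ?case
    unfolding generic.simps by (rule ultrafilter_mono[where p = "p d", OF uf starts]) (rule *)
qed simp

lemma ignores_generic:
  assumes "ignores Z K"
  shows "ignores Z (generic t d x K)"
  using assms
proof (induction t arbitrary: d x K)
  case (Node l i r)
  show ?case
  proof (rule ignoresI)
    fix g g' :: "'a \<Rightarrow> bool list" assume eq: "\<And>j. j \<notin> Z \<Longrightarrow> g j = g' j"
    have "generic l False (x @ w) (generic r True (x @ w) K) (g(i := x @ w)) =
          generic l False (x @ w) (generic r True (x @ w) K) (g'(i := x @ w))" for w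
      using Node.IH(1)[OF Node.IH(2)[OF Node.prems]] by (rule ignoresD) (auto simp: eq)
    then show "generic (Node l i r) d x K g = generic (Node l i r) d x K g'" by simp
  qed
next
  case Leaf
  have "generic Leaf d x K = K" by (rule ext) simp
  then show ?case using Leaf by simp
qed

text \<open>Ultrafilter quantifiers over labels that \<open>K\<close> does not see are
  vacuous.\<close>

lemma generic_drop:
  assumes "ignores Z K" and "set_tree t \<subseteq> Z"
  shows "generic t d x K = K"
  using assms(2)
proof (induction t arbitrary: d x)
  case (Node l i r)
  have "K (g(i := y)) = K g" for y g
    using assms(1) by (rule ignoresD) (use Node.prems in auto)
  then show ?case using Node by (intro ext) (simp add: ultrafilter_const[OF uf])
next
  case Leaf
  show ?case by (rule ext) simp
qed

text \<open>Labels only name coordinates, so an injective renaming is harmless. \<open>S\<close>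
  collects the labels already placed; it grows along the preorder during the induction.\<close>

lemma generic_relabel:
  assumes "\<And>g1 g2. (\<And>i. i \<in> S \<union> set_tree t \<Longrightarrow> g1 i = g2 (h i)) \<Longrightarrow> K1 g1 = K2 g2"
    and "inj_on h (S \<union> set_tree t)" and "\<And>i. i \<in> S \<Longrightarrow> g1 i = g2 (h i)"
  shows "generic t d x K1 g1 = generic (map_tree h t) d x K2 g2"
  using assms
proof (induction t arbitrary: S d x K1 K2 g1 g2)
  case (Node l i r)
  have "generic l False y (generic r True y K1) (g1(i := y)) =
        generic (map_tree h l) False y (generic (map_tree h r) True y K2) (g2(h i := y))" for y
  proof (rule Node.IH(1)[of "insert i S"])
    show "inj_on h (insert i S \<union> set_tree l)"
      using Node.prems(2) by (rule inj_on_subset) auto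
    show "(g1(i := y)) j = (g2(h i := y)) (h j)" if "j \<in> insert i S" for j
      using that Node.prems(3) inj_onD[OF Node.prems(2), of j i] by auto
    show "generic r True y K1 g1 = generic (map_tree h r) True y K2 g2"
      if "\<And>j. j \<in> insert i S \<union> set_tree l \<Longrightarrow> g1 j = g2 (h j)" for g1 g2
    proof (rule Node.IH(2)[of "insert i S \<union> set_tree l"])
      show "inj_on h (insert i S \<union> set_tree l \<union> set_tree r)"
        using Node.prems(2) by (rule inj_on_subset) auto
    qed (use that Node.prems(1) in auto)
  qed
  then show ?case by simp
qed simp

end

section \<open>Finite meet-closed sets as trees\<close>

text \<open>Presents a finite meet-closed set in preorder. A child lies above its parent in the
  right direction but need not be an immediate successor.\<close>

primrec branching :: "bool list tree \<Rightarrow> bool" where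
  "branching Leaf \<longleftrightarrow> True"
| "branching (Node l \<eta> r) \<longleftrightarrow> branching l \<and> branching r \<and>
     (\<forall>\<nu>\<in>set_tree l. prefix (\<eta> @ [False]) \<nu>) \<and> (\<forall>\<nu>\<in>set_tree r. prefix (\<eta> @ [True]) \<nu>)"

primrec full :: "nat \<Rightarrow> bool list \<Rightarrow> bool list tree" where
  "full 0 \<eta> = Leaf"
| "full (Suc n) \<eta> = Node (full n (\<eta> @ [False])) \<eta> (full n (\<eta> @ [True]))"

lemma prefix_cases_bool:
  "prefix \<eta> \<nu> \<longleftrightarrow> \<nu> = \<eta> \<or> prefix (\<eta> @ [False]) \<nu> \<or> prefix (\<eta> @ [True]) (\<nu> :: bool list)"
proof -
  have "prefix \<eta> \<nu> \<longleftrightarrow> \<nu> = \<eta> \<or> (\<exists>d. prefix (\<eta> @ [d]) \<nu>)"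
    by (auto simp: prefix_def) (metis append_Nil2 neq_Nil_conv)
  then show ?thesis by (metis (full_types))
qed

lemma prefix_snoc_unique: "prefix (\<eta> @ [c]) \<nu> \<Longrightarrow> prefix (\<eta> @ [d]) \<nu> \<Longrightarrow> c = d"
  by (auto simp: prefix_def)

lemma set_full: "set_tree (full n \<eta>) = {\<nu>. prefix \<eta> \<nu> \<and> length \<nu> < length \<eta> + n}"
proof (induction n arbitrary: \<eta>)
  case (Suc n)
  have "length \<eta> < length \<nu>" if "prefix (\<eta> @ [d]) \<nu>" for \<nu> d
    using prefix_length_le[OF that] by simp
  then show ?case using Suc by (subst prefix_cases_bool) auto
qed (auto dest: prefix_length_le)

lemma branching_map:
  assumes "branching t"
    and "\<And>\<rho> \<nu> c. \<rho> \<in> set_tree t \<Longrightarrow> \<nu> \<in> set_tree t \<Longrightarrow> prefix (\<rho> @ [c]) \<nu> \<Longrightarrow> prefix (h \<rho> @ [c]) (h \<nu>)"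
  shows "branching (map_tree h t)"
  using assms by (induction t) (auto simp: tree.set_map)

text \<open>A shortest element \<open>\<rho>\<close> lies below all others, since its meet with any
  of them is again in \<open>X\<close> and hence not shorter. The remaining elements split into the
  two cones above \<open>\<rho>\<close>, which are smaller and meet-closed.\<close>

lemma ex_branching:
  assumes "finite X" "\<And>\<eta> \<nu>. \<eta> \<in> X \<Longrightarrow> \<nu> \<in> X \<Longrightarrow> longest_common_prefix \<eta> \<nu> \<in> X"
  shows "\<exists>t. branching t \<and> set_tree t = X"
  using assms
proof (induction "card X" arbitrary: X rule: less_induct)
  case less
  show ?case
  proof (cases "X = {}")
    case True
    then show ?thesis by (intro exI[of _ Leaf]) simp
  next
    case False
    define \<rho> where "\<rho> = arg_min_on length X"
    have \<rho>: "\<rho> \<in> X" "\<And>\<nu>. \<nu> \<in> X \<Longrightarrow> length \<rho> \<le> length \<nu>"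
      unfolding \<rho>_def using less.prems(1) False arg_min_if_finite[of X length]
      by (auto simp: arg_min_least)
    have pre: "prefix \<rho> \<nu>" if "\<nu> \<in> X" for \<nu>
    proof -
      have "length \<rho> \<le> length (longest_common_prefix \<rho> \<nu>)" using less.prems(2) \<rho> that by blast
      then have "longest_common_prefix \<rho> \<nu> = \<rho>"
        using longest_common_prefix_prefix1[of \<rho> \<nu>]
        by (metis prefix_length_prefix prefix_order.antisym prefix_order.order_refl)
      then show ?thesis using longest_common_prefix_prefix2[of \<rho> \<nu>] by simp
    qed
    have "\<exists>t. branching t \<and> set_tree t = {\<nu>\<in>X. prefix (\<rho> @ [d]) \<nu>}" for d
    proof (rule less.hyps)
      have "\<rho> \<notin> {\<nu>\<in>X. prefix (\<rho> @ [d]) \<nu>}" by (auto dest: prefix_length_le)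
      then show "card {\<nu>\<in>X. prefix (\<rho> @ [d]) \<nu>} < card X"
        using less.prems(1) \<rho>(1) by (intro psubset_card_mono psubsetI) blast+
    qed (use less.prems longest_common_prefix_max_prefix in auto)
    then obtain t where t: "branching (t d)" "set_tree (t d) = {\<nu>\<in>X. prefix (\<rho> @ [d]) \<nu>}" for d
      by metis
    have "X = {\<rho>} \<union> set_tree (t False) \<union> set_tree (t True)"
      using pre \<rho>(1) prefix_cases_bool[of \<rho>] unfolding t by blast
    then show ?thesis
      using t by (intro exI[of _ "Node (t False) \<rho> (t True)"]) auto
  qed
qed

section \<open>Generic placements of the full tree and of its meet-closed subsets\<close>

context absorbing_ultrafilters
begin

text \<open>Directions are kept because the word chosen at a node begins with the direction from its
  parent. The first two conjuncts carry the induction: later placements leave earlier labels alone,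
  and a whole subtree lands above \<open>x @ [d]\<close>.\<close>

lemma placed_full:
  assumes "placed (full n \<eta>) d x g g'"
  shows "(\<forall>\<nu>. \<nu> \<notin> set_tree (full n \<eta>) \<longrightarrow> g' \<nu> = g \<nu>) \<and>
    (\<forall>\<nu>\<in>set_tree (full n \<eta>). prefix (x @ [d]) (g' \<nu>)) \<and>
    (\<forall>\<rho>\<in>set_tree (full n \<eta>). \<forall>\<nu>\<in>set_tree (full n \<eta>). \<forall>c. prefix (\<rho> @ [c]) \<nu> \<longrightarrow> prefix (g' \<rho> @ [c]) (g' \<nu>))"
  using assms
proof (induction n arbitrary: \<eta> d x g g')
  case (Suc n)
  let ?L = "set_tree (full n (\<eta> @ [False]))" and ?R = "set_tree (full n (\<eta> @ [True]))"
  obtain v g1 where l: "placed (full n (\<eta> @ [False])) False (x @ d # v) (g(\<eta> := x @ d # v)) g1"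
    and r: "placed (full n (\<eta> @ [True])) True (x @ d # v) g1 g'"
    using Suc.prems by auto
  note L = Suc.IH[OF l] and R = Suc.IH[OF r]
  have S: "set_tree (full (Suc n) \<eta>) = {\<eta>} \<union> ?L \<union> ?R" by auto
  have notin: "\<eta> \<notin> ?L" "\<eta> \<notin> ?R" by (auto simp: set_full dest: prefix_length_le)
  have disj: "?L \<inter> ?R = {}" by (auto simp: set_full dest: prefix_snoc_unique)
  have root: "g' \<eta> = x @ d # v" using L R notin by auto
  have gL: "g' \<nu> = g1 \<nu>" if "\<nu> \<in> ?L" for \<nu> using R that disj by auto
  have bL: "prefix ((x @ d # v) @ [False]) (g' \<nu>)" if "\<nu> \<in> ?L" for \<nu> using gL L that by auto
  have bR: "prefix ((x @ d # v) @ [True]) (g' \<nu>)" if "\<nu> \<in> ?R" for \<nu> using R that by auto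
  have "prefix (x @ [d]) (g' \<nu>)" if "\<nu> \<in> {\<eta>} \<union> ?L \<union> ?R" for \<nu>
  proof -
    have "prefix (x @ d # v) (g' \<nu>)" using that root append_prefixD[OF bL] append_prefixD[OF bR] by auto
    then show ?thesis by (auto simp: prefix_def)
  qed
  moreover have "prefix (g' \<rho> @ [c]) (g' \<nu>)"
    if mem: "\<rho> \<in> {\<eta>} \<union> ?L \<union> ?R" "\<nu> \<in> {\<eta>} \<union> ?L \<union> ?R" "prefix (\<rho> @ [c]) \<nu>" for \<rho> \<nu> c
  proof -
    have "prefix \<eta> \<rho>" using that(1) by (auto simp: set_full dest: append_prefixD)
    then have "\<nu> \<noteq> \<eta>" using that(3) by (auto dest!: prefix_length_le)
    then consider "\<rho> = \<eta>" "\<nu> \<in> ?L" | "\<rho> = \<eta>" "\<nu> \<in> ?R" | "\<rho> \<in> ?L" "\<nu> \<in> ?L" | "\<rho> \<in> ?R" "\<nu> \<in> ?R"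
      | "\<rho> \<in> ?L" "\<nu> \<in> ?R" | "\<rho> \<in> ?R" "\<nu> \<in> ?L"
      using mem by auto
    then show ?thesis
    proof cases
      case 1
      then have "c = False" using that(3) prefix_snoc_unique[of \<eta> c \<nu> False] by (auto simp: set_full)
      then show ?thesis using 1 root bL by auto
    next
      case 2
      then have "c = True" using that(3) prefix_snoc_unique[of \<eta> c \<nu> True] by (auto simp: set_full)
      then show ?thesis using 2 root bR by auto
    next
      case 3
      then show ?thesis using L gL that(3) by auto
    next
      case 4
      then show ?thesis using R that(3) by auto
    next
      case 5
      then have "prefix (\<eta> @ [False]) \<nu>" using that(3)
        by (auto simp: set_full intro: prefix_order.trans dest: append_prefixD)
      then show ?thesis using 5 prefix_snoc_unique[of \<eta> False \<nu> True] by (auto simp: set_full)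
    next
      case 6
      then have "prefix (\<eta> @ [True]) \<nu>" using that(3)
        by (auto simp: set_full intro: prefix_order.trans dest: append_prefixD)
      then show ?thesis using 6 prefix_snoc_unique[of \<eta> False \<nu> True] by (auto simp: set_full)
    qed
  qed
  moreover have "g' \<nu> = g \<nu>" if "\<nu> \<notin> {\<eta>} \<union> ?L \<union> ?R" for \<nu> using that L R by auto
  ultimately show ?case unfolding S by blast
qed simp

text \<open>Nodes outside \<open>t\<close> leave no trace. If the root \<open>\<eta>\<close> belongs
  to \<open>t\<close>, both sides choose the same word and the induction enters both subtrees.
  Otherwise \<open>t\<close> lies in one cone above \<open>\<eta>\<close>, the other cone drops out,
  and \<open>absorb\<close> merges the word of \<open>\<eta>\<close> with the next one.\<close>

lemma generic_full:
  assumes "branching t" "set_tree t \<subseteq> set_tree (full n \<eta>)" "set_tree (full n \<eta>) - set_tree t \<subseteq> Z"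
    and "ignores Z K"
  shows "generic (full n \<eta>) d x K g = generic t d x K g"
  using assms
proof (induction n arbitrary: t \<eta> d x K g)
  case 0
  then show ?case by (cases t) auto
next
  case (Suc n)
  let ?L = "set_tree (full n (\<eta> @ [False]))" and ?R = "set_tree (full n (\<eta> @ [True]))"
  have S: "set_tree (full (Suc n) \<eta>) = {\<eta>} \<union> ?L \<union> ?R" by auto
  have notin: "\<eta> \<notin> ?L" "\<eta> \<notin> ?R" by (auto simp: set_full dest: prefix_length_le)
  have disj: "?L \<inter> ?R = {}" by (auto simp: set_full dest: prefix_snoc_unique)
  show ?case
  proof (cases t)
    case Leaf
    then have "generic (full (Suc n) \<eta>) d x K g = K g"
      using Suc.prems(3) generic_drop[OF Suc.prems(4)] by (metis Diff_empty tree.set(1))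
    then show ?thesis using Leaf by simp
  next
    case (Node l \<rho> r)
    show ?thesis
    proof (cases "\<rho> = \<eta>")
      case True
      have lr: "branching l" "branching r" "\<forall>\<nu>\<in>set_tree l. prefix (\<eta> @ [False]) \<nu>"
        "\<forall>\<nu>\<in>set_tree r. prefix (\<eta> @ [True]) \<nu>"
        using Suc.prems(1) Node True by auto
      have l: "set_tree l \<subseteq> ?L" and r: "set_tree r \<subseteq> ?R"
        using lr(3,4) Suc.prems(2) Node by (auto simp: set_full)
      have Kr: "generic (full n (\<eta> @ [True])) True y K = generic r True y K" for y
        by (intro ext Suc.IH) (use lr l r disj notin Suc.prems Node True in auto)
      have "generic (full n (\<eta> @ [False])) False y (generic r True y K) g' =
            generic l False y (generic r True y K) g'" for y g'
        by (rule Suc.IH) (use ignores_generic lr l r disj notin Suc.prems Node True in auto)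
      then show ?thesis using Kr Node True by simp
    next
      case False
      have "prefix \<eta> \<rho>" using Suc.prems(2) Node by (auto simp: set_full dest: append_prefixD)
      then obtain c where c: "prefix (\<eta> @ [c]) \<rho>" using False prefix_cases_bool[of \<eta> \<rho>] by auto
      have "prefix \<rho> \<nu>" if "\<nu> \<in> set_tree t" for \<nu>
        using that Suc.prems(1) Node by (auto dest: append_prefixD)
      then have above: "prefix (\<eta> @ [c]) \<nu>" if "\<nu> \<in> set_tree t" for \<nu>
        using that c prefix_order.trans by blast
      then have t: "set_tree t \<subseteq> set_tree (full n (\<eta> @ [c]))" using Suc.prems(2) by (auto simp: set_full)
      have IH: "generic (full n (\<eta> @ [c])) c y K g' = generic t c y K g'" for y g'
        by (rule Suc.IH) (use t Suc.prems in \<open>cases c; auto\<close>)+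
      have drop: "generic (full n (\<eta> @ [\<not> c])) e y K' = K'" if "ignores Z K'" for e y K'
        using that by (rule generic_drop) (use t Suc.prems disj in \<open>cases c; auto\<close>)
      have upd: "generic t c y K (g(\<eta> := z)) = generic t c y K g" for y z
        using ignores_generic[OF Suc.prems(4)] by (rule ignoresD) (use Suc.prems t notin in \<open>cases c; auto\<close>)
      \<comment> \<open>In preorder the dropped cone comes before the surviving one if
        \<open>c\<close> is \<open>True\<close> and after it otherwise; either way the two remaining
        words become adjacent.\<close>
      have "generic (full (Suc n) \<eta>) d x K g = p d (\<lambda>w. generic t c (x @ w) K g)"
      proof (cases c)
        case True
        then show ?thesis using IH upd drop[OF ignores_generic[OF Suc.prems(4)]] by simp
      next
        case False
        then show ?thesis using IH upd drop[OF Suc.prems(4)] by simp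
      qed
      also have "\<dots> = uf_prod (p d) (p c)
        (\<lambda>w. generic l False (x @ w) (generic r True (x @ w) K) (g(\<rho> := x @ w)))"
        unfolding uf_prod_def Node by simp
      also have "\<dots> = generic t d x K g" unfolding absorb Node by simp
      finally show ?thesis .
    qed
  qed
qed

text \<open>By \<open>generic_full\<close> each side reduces to a branching tree, on the values of
  \<open>x\<close> and of \<open>y\<close> respectively, and the second tree is a relabelling of the
  first. \<open>pre\<close> ensures that the relabelled tree is branching again.\<close>

lemma generic_similar:
  fixes x y :: "'j \<Rightarrow> bool list"
  assumes "finite J" and meet: "\<And>a b. a \<in> J \<Longrightarrow> b \<in> J \<Longrightarrow> longest_common_prefix (x a) (x b) \<in> x ` J"
    and eq: "\<And>a b. a \<in> J \<Longrightarrow> b \<in> J \<Longrightarrow> x a = x b \<longleftrightarrow> y a = y b"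
    and pre: "\<And>a b c. a \<in> J \<Longrightarrow> b \<in> J \<Longrightarrow> prefix (x a @ [c]) (x b) \<Longrightarrow> prefix (y a @ [c]) (y b)"
    and len: "\<And>a. a \<in> J \<Longrightarrow> length (x a) < n" "\<And>a. a \<in> J \<Longrightarrow> length (y a) < n"
    and F: "\<And>u v. (\<And>a. a \<in> J \<Longrightarrow> u a = v a) \<Longrightarrow> F u = F v"
  shows "generic (full n []) d z (\<lambda>g. F (\<lambda>a. g (x a))) g = generic (full n []) d z (\<lambda>g. F (\<lambda>a. g (y a))) g"
proof -
  obtain t where t: "branching t" "set_tree t = x ` J"
  proof -
    have "\<exists>t. branching t \<and> set_tree t = x ` J"
      by (rule ex_branching) (use \<open>finite J\<close> meet in auto)
    then show ?thesis using that by blast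
  qed
  \<comment> \<open>The inverse picks an arbitrary index; by \<open>eq\<close> the value of
    \<open>y\<close> there is independent of the choice.\<close>
  define h where "h \<eta> = y (inv_into J x \<eta>)" for \<eta>
  have h: "h (x a) = y a" if "a \<in> J" for a
    unfolding h_def using eq that by (metis f_inv_into_f imageI inv_into_into)
  have "inj_on h (set_tree t)" unfolding t by (rule inj_onI) (auto simp: h eq)
  have "generic (full n []) d z (\<lambda>g. F (\<lambda>a. g (x a))) g = generic t d z (\<lambda>g. F (\<lambda>a. g (x a))) g"
    by (rule generic_full[where Z = "- x ` J"]) (use t len(1) in \<open>auto simp: set_full intro!: F ignoresI\<close>)
  also have "\<dots> = generic (map_tree h t) d z (\<lambda>g. F (\<lambda>a. g (y a))) g"
    by (rule generic_relabel[where S = "{}"]) (use \<open>inj_on h (set_tree t)\<close> t h in \<open>auto intro!: F\<close>)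
  also have "\<dots> = generic (full n []) d z (\<lambda>g. F (\<lambda>a. g (y a))) g"
  proof (rule generic_full[where Z = "- y ` J", symmetric])
    show "branching (map_tree h t)"
      by (rule branching_map) (use t h pre in auto)
    have "set_tree (map_tree h t) = y ` J" using t h by (simp add: tree.set_map image_image)
    then show "set_tree (map_tree h t) \<subseteq> set_tree (full n [])"
      "set_tree (full n []) - set_tree (map_tree h t) \<subseteq> - y ` J"
      using len(2) by (auto simp: set_full)
  qed (auto intro!: F ignoresI)
  finally show ?thesis .
qed

end

section \<open>Formulas and saturation\<close>

lemma eval_cong: "(\<And>i. i \<in> fv_trm t \<Longrightarrow> s i = s' i) \<Longrightarrow> eval M s t = eval M s' t"
proof (induction t)
  case (Fn f ts)
  then have "map (eval M s) ts = map (eval M s') ts" by (intro map_cong refl) auto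
  then show ?case by (simp only: eval.simps)
qed simp

lemma sat_cong: "(\<And>i. i \<in> fv \<psi> \<Longrightarrow> s i = s' i) \<Longrightarrow> sat M \<psi> s = sat M \<psi> s'"
proof (induction \<psi> arbitrary: s s')
  case (Eq t u)
  then show ?case using eval_cong[of t s s' M] eval_cong[of u s s' M] by auto
next
  case (Rel r ts)
  then have "map (eval M s) ts = map (eval M s') ts" by (intro map_cong refl eval_cong) auto
  then show ?case by (simp only: sat.simps)
next
  case (Ex i \<psi>)
  have "sat M \<psi> (s(i := b)) = sat M \<psi> (s'(i := b))" for b
    by (rule Ex.IH) (use Ex.prems in auto)
  then show ?case by simp
next
  case (Neg \<psi>)
  then show ?case by (metis fv.simps(3) sat.simps(3))
next
  case (Conj \<psi> \<chi>)
  have "sat M \<psi> s = sat M \<psi> s'" "sat M \<chi> s = sat M \<chi> s'"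
    using Conj.prems by (auto intro!: Conj.IH)
  then show ?case by simp
qed

lemma finite_fv_trm: "finite (fv_trm t)"
  by (induction t) auto

lemma finite_fv: "finite (fv \<psi>)"
  by (induction \<psi>) (auto simp: finite_fv_trm)

fun rename_trm :: "(nat \<Rightarrow> nat) \<Rightarrow> 'f trm \<Rightarrow> 'f trm" where
  "rename_trm r (Var i) = Var (r i)"
| "rename_trm r (Fn f ts) = Fn f (map (rename_trm r) ts)"

lemma eval_rename_trm: "eval M s (rename_trm r t) = eval M (\<lambda>i. s (r i)) t"
proof (induction t)
  case (Fn f ts)
  then have "map (eval M s \<circ> rename_trm r) ts = map (eval M (\<lambda>i. s (r i))) ts" by (intro map_cong refl) auto
  then show ?case by (simp only: rename_trm.simps eval.simps map_map)
qed simp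

text \<open>Stated semantically, with \<open>r\<close> arbitrary. Under a quantifier the bound
  variable moves to some \<open>j\<close> outside the image of \<open>fv \<psi>\<close> under
  \<open>r\<close>, which prevents capture.\<close>

lemma ex_rename: "\<exists>\<psi>'. \<forall>s. sat M \<psi>' s \<longleftrightarrow> sat M \<psi> (\<lambda>i. s (r i))"
proof (induction \<psi> arbitrary: r)
  case (Eq t u)
  show ?case by (rule exI[of _ "Eq (rename_trm r t) (rename_trm r u)"]) (simp add: eval_rename_trm)
next
  case (Rel R ts)
  have "map (eval M s \<circ> rename_trm r) ts = map (eval M (\<lambda>i. s (r i))) ts" for s
    by (simp add: eval_rename_trm)
  then show ?case by (intro exI[of _ "Rel R (map (rename_trm r) ts)"]) (simp only: sat.simps map_map simp_thms)
next
  case (Neg \<psi>)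
  then show ?case by (metis sat.simps(3))
next
  case (Conj \<psi> \<chi>)
  then show ?case by (metis sat.simps(4))
next
  case (Ex i \<psi>)
  obtain j where j: "j \<notin> r ` fv \<psi>"
    using ex_new_if_finite[OF infinite_UNIV_nat] finite_fv by blast
  obtain \<psi>' where \<psi>': "\<And>s. sat M \<psi>' s \<longleftrightarrow> sat M \<psi> (\<lambda>m. s ((r(i := j)) m))" using Ex.IH by blast
  have "sat M \<psi> (\<lambda>m. (s(j := b)) ((r(i := j)) m)) = sat M \<psi> ((\<lambda>m. s (r m))(i := b))" for s b
    by (rule sat_cong) (use j in auto)
  then show ?case by (intro exI[of _ "Ex j \<psi>'"]) (simp add: \<psi>')
qed

lemma ex_conjunction:
  assumes "finite F"
  shows "\<exists>\<psi>. \<forall>s. sat M \<psi> s \<longleftrightarrow> (\<forall>\<chi>\<in>F. sat M \<chi> s)"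
  using assms
proof induction
  case empty
  show ?case by (rule exI[of _ "Eq (Var 0) (Var 0)"]) simp
next
  case (insert \<chi> F)
  then obtain \<psi> where "\<forall>s. sat M \<psi> s \<longleftrightarrow> (\<forall>\<chi>\<in>F. sat M \<chi> s)" by blast
  then show ?case by (intro exI[of _ "Conj \<chi> \<psi>"]) simp
qed

lemma ex_existential_closure:
  assumes "finite V"
  shows "\<exists>\<chi>. \<forall>s. sat M \<chi> s \<longleftrightarrow>
    (\<exists>s'. (\<forall>i. i \<notin> V \<longrightarrow> s' i = s i) \<and> (\<forall>i\<in>V. s' i \<in> univ M) \<and> sat M \<psi> s')"
  using assms
proof induction
  case empty
  show ?case by (intro exI[of _ \<psi>]) (auto simp flip: fun_eq_iff)
next
  case (insert v V)
  then obtain \<chi> where \<chi>: "\<And>s. sat M \<chi> s \<longleftrightarrow>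
    (\<exists>s'. (\<forall>i. i \<notin> V \<longrightarrow> s' i = s i) \<and> (\<forall>i\<in>V. s' i \<in> univ M) \<and> sat M \<psi> s')" by blast
  have "sat M (Ex v \<chi>) s \<longleftrightarrow>
    (\<exists>s'. (\<forall>i. i \<notin> insert v V \<longrightarrow> s' i = s i) \<and> (\<forall>i\<in>insert v V. s' i \<in> univ M) \<and> sat M \<psi> s')" for s
  proof
    assume "sat M (Ex v \<chi>) s"
    then obtain b s' where "b \<in> univ M" "\<forall>i. i \<notin> V \<longrightarrow> s' i = (s(v := b)) i" "\<forall>i\<in>V. s' i \<in> univ M" "sat M \<psi> s'"
      by (auto simp: \<chi>)
    then show "\<exists>s'. (\<forall>i. i \<notin> insert v V \<longrightarrow> s' i = s i) \<and> (\<forall>i\<in>insert v V. s' i \<in> univ M) \<and> sat M \<psi> s'"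
      using insert.hyps(2) by (intro exI[of _ s']) auto
  next
    assume "\<exists>s'. (\<forall>i. i \<notin> insert v V \<longrightarrow> s' i = s i) \<and> (\<forall>i\<in>insert v V. s' i \<in> univ M) \<and> sat M \<psi> s'"
    then obtain s' where s': "\<forall>i. i \<notin> insert v V \<longrightarrow> s' i = s i" "\<forall>i\<in>insert v V. s' i \<in> univ M" "sat M \<psi> s'" by blast
    then have "sat M \<chi> (s(v := s' v))" unfolding \<chi> by (intro exI[of _ s']) auto
    then show "sat M (Ex v \<chi>) s" using s'(2) by auto
  qed
  then show ?case by blast
qed

text \<open>Makes consistency of finitely many instances a single formula about the parameters, so
  that it can be transferred between trees like any other formula.\<close>

lemma ex_consistency_formula:
  fixes code :: "'n \<Rightarrow> nat \<Rightarrow> nat"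
  assumes "finite F" "fv \<phi> \<subseteq> {..<k + l}"
  shows "\<exists>\<chi>. \<forall>s. sat M \<chi> s \<longleftrightarrow>
    (\<exists>b. (\<forall>i<k. b i \<in> univ M) \<and> (\<forall>\<mu>\<in>F. sat M \<phi> (asg k b (\<lambda>i. s (code \<mu> i)))))"
proof -
  \<comment> \<open>\<open>V\<close> exceeds all parameter variables in use, so the variables from
    \<open>V\<close> to \<open>V + k - 1\<close> are free to stand for the tuple x.\<close>
  have "finite (\<Union>\<mu>\<in>F. code \<mu> ` {..<l})" using assms(1) by blast
  then obtain V where "\<forall>j\<in>(\<Union>\<mu>\<in>F. code \<mu> ` {..<l}). j < V"
    using finite_nat_set_iff_bounded by blast
  then have V: "code \<mu> i < V" if "\<mu> \<in> F" "i < l" for \<mu> i using that by blast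
  define r where "r \<mu> i = (if i < k then V + i else code \<mu> (i - k))" for \<mu> i
  have "\<forall>\<mu>. \<exists>\<psi>. \<forall>s. sat M \<psi> s \<longleftrightarrow> sat M \<phi> (\<lambda>i. s (r \<mu> i))" using ex_rename by blast
  then obtain f where f: "\<And>\<mu> s. sat M (f \<mu>) s \<longleftrightarrow> sat M \<phi> (\<lambda>i. s (r \<mu> i))" by metis
  obtain \<psi> where \<psi>: "\<And>s. sat M \<psi> s \<longleftrightarrow> (\<forall>\<chi>\<in>f ` F. sat M \<chi> s)"
    using ex_conjunction[of "f ` F" M] assms(1) by blast
  obtain \<chi> where \<chi>: "\<And>s. sat M \<chi> s \<longleftrightarrow> (\<exists>s'. (\<forall>i. i \<notin> {V..<V + k} \<longrightarrow> s' i = s i) \<and>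
      (\<forall>i\<in>{V..<V + k}. s' i \<in> univ M) \<and> sat M \<psi> s')"
    using ex_existential_closure[of "{V..<V + k}" M \<psi>] by blast
  have key: "sat M (f \<mu>) s' \<longleftrightarrow> sat M \<phi> (asg k b (\<lambda>i. s (code \<mu> i)))"
    if "\<mu> \<in> F" "\<forall>i. i \<notin> {V..<V + k} \<longrightarrow> s' i = s i" "\<forall>i<k. s' (V + i) = b i" for \<mu> s' s b
    unfolding f
  proof (rule sat_cong)
    fix i assume "i \<in> fv \<phi>"
    then have i: "i < k + l" using assms(2) by auto
    show "s' (r \<mu> i) = asg k b (\<lambda>i. s (code \<mu> i)) i"
    proof (cases "i < k")
      case False
      then have "code \<mu> (i - k) < V" using V that(1) i by auto
      then show ?thesis using that(2) False by (simp add: r_def asg_def)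
    qed (use that(3) in \<open>simp add: r_def asg_def\<close>)
  qed
  have "sat M \<chi> s \<longleftrightarrow> (\<exists>b. (\<forall>i<k. b i \<in> univ M) \<and> (\<forall>\<mu>\<in>F. sat M \<phi> (asg k b (\<lambda>i. s (code \<mu> i)))))" for s
  proof
    assume "sat M \<chi> s"
    then obtain s' where s': "\<forall>i. i \<notin> {V..<V + k} \<longrightarrow> s' i = s i" "\<forall>i\<in>{V..<V + k}. s' i \<in> univ M" "sat M \<psi> s'"
      using \<chi> by blast
    then show "\<exists>b. (\<forall>i<k. b i \<in> univ M) \<and> (\<forall>\<mu>\<in>F. sat M \<phi> (asg k b (\<lambda>i. s (code \<mu> i))))"
      using key[OF _ s'(1), of _ "\<lambda>i. s' (V + i)"] by (intro exI[of _ "\<lambda>i. s' (V + i)"]) (auto simp: \<psi>)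
  next
    assume "\<exists>b. (\<forall>i<k. b i \<in> univ M) \<and> (\<forall>\<mu>\<in>F. sat M \<phi> (asg k b (\<lambda>i. s (code \<mu> i))))"
    then obtain b where b: "\<forall>i<k. b i \<in> univ M" "\<forall>\<mu>\<in>F. sat M \<phi> (asg k b (\<lambda>i. s (code \<mu> i)))" by blast
    define s' where "s' j = (if j \<in> {V..<V + k} then b (j - V) else s j)" for j
    have "sat M \<psi> s'" using key[of _ s' s b] b(2) by (auto simp: \<psi> s'_def)
    then show "sat M \<chi> s" unfolding \<chi> using b(1) by (intro exI[of _ s']) (auto simp: s'_def)
  qed
  then show ?thesis by blast
qed

section \<open>Realising types in countably many variables\<close>

text \<open>Saturation supplies one element at a time, so the coordinates are realised successively.
  The invariant \<open>ok n\<close> says that every finite part of \<open>\<Sigma>\<close> can still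
  be satisfied by changing only coordinates from \<open>n\<close> on; \<open>ext_formula\<close>
  makes this expressible.\<close>

lemma aleph1_saturated_realizes:
  fixes M :: "('a, 'f, 'r) struct" and \<Sigma> :: "('f, 'r) fml set"
  assumes "aleph1_saturated M" "is_struct M"
    and fin: "\<And>\<Sigma>0. finite \<Sigma>0 \<Longrightarrow> \<Sigma>0 \<subseteq> \<Sigma> \<Longrightarrow> \<exists>s. range s \<subseteq> univ M \<and> (\<forall>\<psi>\<in>\<Sigma>0. sat M \<psi> s)"
  shows "\<exists>s. range s \<subseteq> univ M \<and> (\<forall>\<psi>\<in>\<Sigma>. sat M \<psi> s)"
proof -
  define ext where "ext n \<Sigma>0 s \<longleftrightarrow>
    (\<exists>s'. range s' \<subseteq> univ M \<and> (\<forall>i<n. s' i = s i) \<and> (\<forall>\<psi>\<in>\<Sigma>0. sat M \<psi> s'))" for n \<Sigma>0 s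
  define ok where "ok n s \<longleftrightarrow> range s \<subseteq> univ M \<and> (\<forall>\<Sigma>0. finite \<Sigma>0 \<and> \<Sigma>0 \<subseteq> \<Sigma> \<longrightarrow> ext n \<Sigma>0 s)" for n s
  have ext_formula: "\<exists>\<chi>. \<forall>s. range s \<subseteq> univ M \<longrightarrow> (sat M \<chi> s \<longleftrightarrow> ext n \<Sigma>0 s)" if "finite \<Sigma>0" for n \<Sigma>0
  proof -
    obtain \<psi> where \<psi>: "\<And>s. sat M \<psi> s \<longleftrightarrow> (\<forall>\<chi>\<in>\<Sigma>0. sat M \<chi> s)"
      using ex_conjunction[OF \<open>finite \<Sigma>0\<close>] by blast
    let ?V = "fv \<psi> - {..<n}"
    obtain \<chi> where \<chi>: "\<And>s. sat M \<chi> s \<longleftrightarrow> (\<exists>s'. (\<forall>i. i \<notin> ?V \<longrightarrow> s' i = s i) \<and>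
      (\<forall>i\<in>?V. s' i \<in> univ M) \<and> sat M \<psi> s')"
      using ex_existential_closure[of ?V M \<psi>] finite_fv by blast
    have "sat M \<chi> s \<longleftrightarrow> ext n \<Sigma>0 s" if s: "range s \<subseteq> univ M" for s
    proof
      assume "sat M \<chi> s"
      then obtain s' where s': "\<forall>i. i \<notin> ?V \<longrightarrow> s' i = s i" "\<forall>i\<in>?V. s' i \<in> univ M" "sat M \<psi> s'"
        using \<chi> by blast
      have "s' i \<in> univ M" for i using s' s by (metis rangeI subsetD)
      then show "ext n \<Sigma>0 s" unfolding ext_def using s' \<psi> by (intro exI[of _ s']) auto
    next
      assume "ext n \<Sigma>0 s"
      then obtain s' where s': "range s' \<subseteq> univ M" "\<forall>i<n. s' i = s i" "sat M \<psi> s'"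
        unfolding ext_def \<psi> by blast
      define s'' where "s'' i = (if i \<in> ?V then s' i else s i)" for i
      have "sat M \<psi> s'' = sat M \<psi> s'" by (rule sat_cong) (use s'(2) in \<open>auto simp: s''_def\<close>)
      then show "sat M \<chi> s" unfolding \<chi> using s' by (intro exI[of _ s'']) (auto simp: s''_def)
    qed
    then show ?thesis by blast
  qed
  have step: "\<exists>s'. ok (Suc n) s' \<and> (\<exists>b. s' = s(n := b))" if "ok n s" for n s
  proof -
    \<comment> \<open>\<open>aleph1_saturated\<close> reserves variable 0 for the unknown, so
      coordinate \<open>n\<close> is read there and every other coordinate is shifted up by
      one.\<close>
    define r where "r i = (if i = n then 0 else Suc i)" for i
    have "\<forall>\<Sigma>0. \<exists>\<chi>. finite \<Sigma>0 \<longrightarrow> (\<forall>s. range s \<subseteq> univ M \<longrightarrow> (sat M \<chi> s \<longleftrightarrow> ext (Suc n) \<Sigma>0 (\<lambda>i. s (r i))))"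
    proof
      fix \<Sigma>0 :: "('f, 'r) fml set"
      show "\<exists>\<chi>. finite \<Sigma>0 \<longrightarrow> (\<forall>s. range s \<subseteq> univ M \<longrightarrow> (sat M \<chi> s \<longleftrightarrow> ext (Suc n) \<Sigma>0 (\<lambda>i. s (r i))))"
      proof (cases "finite \<Sigma>0")
        case True
        obtain \<chi>0 where \<chi>0: "\<And>s. range s \<subseteq> univ M \<Longrightarrow> sat M \<chi>0 s \<longleftrightarrow> ext (Suc n) \<Sigma>0 s"
          using ext_formula[OF True] by blast
        obtain \<chi> where \<chi>: "\<And>s. sat M \<chi> s \<longleftrightarrow> sat M \<chi>0 (\<lambda>i. s (r i))" using ex_rename by blast
        have "range (\<lambda>i. s (r i)) \<subseteq> univ M" if "range s \<subseteq> univ M" for s using that by auto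
        then show ?thesis using \<chi> \<chi>0 by (intro exI[of _ \<chi>]) auto
      qed simp
    qed
    then obtain \<chi> where \<chi>: "\<And>\<Sigma>0 s. finite \<Sigma>0 \<Longrightarrow> range s \<subseteq> univ M \<Longrightarrow> sat M (\<chi> \<Sigma>0) s \<longleftrightarrow> ext (Suc n) \<Sigma>0 (\<lambda>i. s (r i))"
      by metis
    \<comment> \<open>The entry \<open>s 0\<close> at position 0 is only a placeholder in the
      universe, to be overwritten by the unknown.\<close>
    define t where "t = case_nat (s 0) s"
    have s: "range s \<subseteq> univ M" using that unfolding ok_def by blast
    then have t: "range t \<subseteq> univ M" unfolding t_def by (auto split: nat.split)
    have tr: "(\<lambda>i. (t(0 := b)) (r i)) = s(n := b)" for b unfolding t_def r_def by auto
    have tb: "range (t(0 := b)) \<subseteq> univ M" if "b \<in> univ M" for b using t that by auto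
    let ?A = "{\<Sigma>0. finite \<Sigma>0 \<and> \<Sigma>0 \<subseteq> \<Sigma>}"
    have "\<exists>b\<in>univ M. \<forall>\<psi>\<in>\<chi> ` ?A. sat M \<psi> (t(0 := b))"
    proof -
      have "\<exists>b\<in>univ M. \<forall>\<psi>\<in>C. sat M \<psi> (t(0 := b))" if C: "finite C" "C \<subseteq> \<chi> ` ?A" for C
      proof -
        obtain D where D: "D \<subseteq> ?A" "finite D" "C = \<chi> ` D" using finite_subset_image[OF C] by blast
        then have "finite (\<Union>D)" "\<Union>D \<subseteq> \<Sigma>" by auto
        \<comment> \<open>One extension serving the union of the finitely many sets in
          \<open>D\<close> supplies a value at \<open>n\<close> for all of them at once.\<close>
        then obtain s' where s': "range s' \<subseteq> univ M" "\<forall>i<n. s' i = s i" "\<forall>\<psi>\<in>\<Union>D. sat M \<psi> s'"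
          using \<open>ok n s\<close> unfolding ok_def ext_def by meson
        have "s' n \<in> univ M" using s'(1) by auto
        moreover have "sat M (\<chi> \<Sigma>0) (t(0 := s' n))" if "\<Sigma>0 \<in> D" for \<Sigma>0
        proof -
          have "ext (Suc n) \<Sigma>0 (s(n := s' n))"
            unfolding ext_def using s' that by (intro exI[of _ s']) auto
          moreover have "finite \<Sigma>0" using D that by auto
          ultimately show ?thesis using \<chi>[OF _ tb[OF \<open>s' n \<in> univ M\<close>]] tr by simp
        qed
        ultimately show ?thesis using D(3) by blast
      qed
      then show ?thesis
        using assms(1)[unfolded aleph1_saturated_def, THEN spec[of _ "\<chi> ` ?A"], THEN spec[of _ t]] t by auto
    qed
    then obtain b where b: "b \<in> univ M" "\<And>\<Sigma>0. \<Sigma>0 \<in> ?A \<Longrightarrow> sat M (\<chi> \<Sigma>0) (t(0 := b))" by blast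
    have "ext (Suc n) \<Sigma>0 (s(n := b))" if "\<Sigma>0 \<in> ?A" for \<Sigma>0
      using b(2)[OF that] \<chi>[OF _ tb[OF b(1)]] that tr by simp
    moreover have "range (s(n := b)) \<subseteq> univ M" using s b(1) by auto
    ultimately have "ok (Suc n) (s(n := b))" unfolding ok_def by blast
    then show ?thesis by blast
  qed
  obtain u where u: "u \<in> univ M" using \<open>is_struct M\<close> unfolding is_struct_def by blast
  have "ok 0 (\<lambda>_. u)" using u fin unfolding ok_def ext_def by auto
  then obtain S where S: "\<And>n. ok n (S n)" "\<And>n. \<exists>b. S (Suc n) = (S n)(n := b)"
    using dependent_nat_choice[of ok "\<lambda>n s s'. \<exists>b. s' = s(n := b)"] step by blast
  \<comment> \<open>Step \<open>i\<close> is the only one that changes coordinate \<open>i\<close>,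
    so its value is final in \<open>S (Suc i)\<close>.\<close>
  define s where "s i = S (Suc i) i" for i
  have s: "S n i = s i" if "i < n" for n i
    using that
  proof (induction n)
    case (Suc n)
    then show ?case using S(2)[of n] by (cases "i = n") (auto simp: s_def)
  qed simp
  have "sat M \<psi> s" if "\<psi> \<in> \<Sigma>" for \<psi>
  proof -
    obtain n where n: "\<forall>i\<in>fv \<psi>. i < n" using finite_fv finite_nat_set_iff_bounded by blast
    have "ext n {\<psi>} (S n)" using S(1)[of n] that unfolding ok_def by blast
    then obtain s' where s': "\<forall>i<n. s' i = S n i" "sat M \<psi> s'" unfolding ext_def by blast
    have "sat M \<psi> s' = sat M \<psi> s" by (rule sat_cong) (use n s s' in auto)
    then show ?thesis using s' by blast
  qed
  moreover have "range s \<subseteq> univ M" using S(1) unfolding s_def ok_def by blast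
  ultimately show ?thesis by blast
qed

section \<open>Indiscernible trees\<close>

lemma branching_full: "branching (full n \<eta>)"
  by (induction n arbitrary: \<eta>) (auto simp: set_full)

definition branch_preserving_on :: "bool list set \<Rightarrow> (bool list \<Rightarrow> bool list) \<Rightarrow> bool" where
  "branch_preserving_on X g \<longleftrightarrow>
    (\<forall>\<rho>\<in>X. \<forall>\<nu>\<in>X. \<forall>c. prefix (\<rho> @ [c]) \<nu> \<longrightarrow> prefix (g \<rho> @ [c]) (g \<nu>))"

text \<open>Bundles the combinatorial hypotheses of \<open>generic_similar\<close>. An index set
  \<open>J\<close> allows the variables of a formula to be mapped to entries with
  repetition.\<close>

definition alpha_similar :: "'j set \<Rightarrow> ('j \<Rightarrow> bool list) \<Rightarrow> ('j \<Rightarrow> bool list) \<Rightarrow> bool" where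
  "alpha_similar J x y \<longleftrightarrow> finite J \<and>
    (\<forall>a\<in>J. \<forall>b\<in>J. longest_common_prefix (x a) (x b) \<in> x ` J \<and> (x a = x b \<longleftrightarrow> y a = y b) \<and>
      (\<forall>c. prefix (x a @ [c]) (x b) \<longrightarrow> prefix (y a @ [c]) (y b)))"

text \<open>\<open>c\<close> realises the formulas that hold of \<open>e\<close> composed with a
  generic placement. Indiscernibility is \<open>generic_similar\<close>; the last clause, that
  \<open>c\<close> is modelled on \<open>e\<close>, follows from \<open>generic_if_placed\<close>
  and \<open>placed_full\<close>.\<close>

lemma (in absorbing_ultrafilters) ex_alpha_indiscernible:
  fixes M :: "('a, 'f, 'r) struct" and e :: "bool list \<Rightarrow> nat \<Rightarrow> 'a"
  assumes M: "aleph1_saturated M" "is_struct M" and e: "\<And>\<mu> i. e \<mu> i \<in> univ M"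
  shows "\<exists>c. (\<forall>\<mu> i. c \<mu> i \<in> univ M) \<and>
    (\<forall>(J :: 'j set) x y (\<psi> :: ('f, 'r) fml) j i.
      alpha_similar J x y \<longrightarrow> (\<forall>m\<in>fv \<psi>. j m \<in> J) \<longrightarrow>
      (sat M \<psi> (\<lambda>m. c (x (j m)) (i m)) \<longleftrightarrow> sat M \<psi> (\<lambda>m. c (y (j m)) (i m)))) \<and>
    (\<forall>X (\<psi> :: ('f, 'r) fml) \<mu> i. finite X \<longrightarrow>
      (\<forall>g. branch_preserving_on X g \<longrightarrow> sat M \<psi> (\<lambda>m. e (g (\<mu> m)) (i m))) \<longrightarrow>
      sat M \<psi> (\<lambda>m. c (\<mu> m) (i m)))"
proof -
  \<comment> \<open>Each variable codes a pair of a node and a coordinate, so one assignment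
    describes a whole tree of tuples.\<close>
  define node :: "nat \<Rightarrow> bool list" where "node m = fst (from_nat m :: bool list \<times> nat)" for m
  define coord :: "nat \<Rightarrow> nat" where "coord m = snd (from_nat m :: bool list \<times> nat)" for m
  define code :: "bool list \<Rightarrow> nat \<Rightarrow> nat" where "code \<mu> i = to_nat (\<mu>, i)" for \<mu> i
  have decode [simp]: "node (code \<mu> i) = \<mu>" "coord (code \<mu> i) = i" for \<mu> i
    by (simp_all add: node_def coord_def code_def)
  define val where "val g m = e (g (node m)) (coord m)" for g m
  \<comment> \<open>The direction \<open>False\<close> at the root and the default placement are
    arbitrary choices.\<close>
  define gen where "gen n K \<longleftrightarrow> generic (full n []) False [] K (\<lambda>_. [])" for n and K :: "(bool list \<Rightarrow> bool list) \<Rightarrow> bool"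
  define bound where "bound \<psi> n \<longleftrightarrow> (\<forall>m\<in>fv \<psi>. length (node m) < n)" for \<psi> :: "('f, 'r) fml" and n
  have ex_bound: "\<exists>n. bound \<psi> n \<and> n0 \<le> n" for \<psi> n0
  proof -
    have "finite ((\<lambda>m. length (node m)) ` fv \<psi>)" using finite_fv by blast
    then obtain n where n: "\<forall>j\<in>(\<lambda>m. length (node m)) ` fv \<psi>. j < n" using finite_nat_set_iff_bounded by blast
    then have "bound \<psi> (max n n0)" unfolding bound_def by auto
    then show ?thesis by (intro exI[of _ "max n n0"]) simp
  qed
  have bound_mono: "bound \<psi> n" if "bound \<psi> n0" "n0 \<le> n" for \<psi> n0 n
    using that unfolding bound_def by auto
  \<comment> \<open>Generic truth does not depend on the height of the full tree, once it contains
    all nodes mentioned.\<close>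
  have gen_mono: "gen n (\<lambda>g. sat M \<psi> (val g)) \<longleftrightarrow> gen n0 (\<lambda>g. sat M \<psi> (val g))"
    if b: "bound \<psi> n0" "n0 \<le> n" for \<psi> n0 n
    unfolding gen_def
  proof (rule generic_full[where Z = "- {\<nu>. length \<nu> < n0}"])
    show "ignores (- {\<nu>. length \<nu> < n0}) (\<lambda>g. sat M \<psi> (val g))"
      by (intro ignoresI sat_cong) (use b(1) in \<open>auto simp: val_def bound_def\<close>)
  qed (use b(2) in \<open>auto simp: set_full branching_full\<close>)
  define \<Sigma> where "\<Sigma> = {\<psi>. \<exists>n. bound \<psi> n \<and> gen n (\<lambda>g. sat M \<psi> (val g))}"
  have \<Sigma>: "\<psi> \<in> \<Sigma> \<longleftrightarrow> gen n (\<lambda>g. sat M \<psi> (val g))" if n: "bound \<psi> n" for \<psi> n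
  proof
    assume "\<psi> \<in> \<Sigma>"
    then obtain n' where n': "bound \<psi> n'" "gen n' (\<lambda>g. sat M \<psi> (val g))" unfolding \<Sigma>_def by blast
    then show "gen n (\<lambda>g. sat M \<psi> (val g))"
      using gen_mono[OF n, of n'] gen_mono[OF n'(1), of n] by (cases "n \<le> n'") auto
  qed (use n in \<open>auto simp: \<Sigma>_def\<close>)
  have "\<exists>s. range s \<subseteq> univ M \<and> (\<forall>\<psi>\<in>\<Sigma>. sat M \<psi> s)"
  proof (rule aleph1_saturated_realizes[OF M])
    fix \<Sigma>0 assume \<Sigma>0: "finite \<Sigma>0" "\<Sigma>0 \<subseteq> \<Sigma>"
    have "\<forall>\<psi>. \<exists>n. bound \<psi> n" using ex_bound[of _ 0] by blast
    from choice[OF this] obtain b where b: "\<And>\<psi>. bound \<psi> (b \<psi>)" by blast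
    define n where "n = Max (insert 0 (b ` \<Sigma>0))"
    have "bound \<psi> n" if "\<psi> \<in> \<Sigma>0" for \<psi>
      using b by (rule bound_mono) (use that \<Sigma>0(1) in \<open>auto simp: n_def\<close>)
    then have "\<forall>\<psi>\<in>\<Sigma>0. gen n (\<lambda>g. sat M \<psi> (val g))" using \<Sigma> \<Sigma>0(2) by blast
    then have "gen n (\<lambda>g. \<forall>\<psi>\<in>\<Sigma>0. sat M \<psi> (val g))" unfolding gen_def generic_ball[OF \<Sigma>0(1)] .
    then obtain g where "\<forall>\<psi>\<in>\<Sigma>0. sat M \<psi> (val g)" unfolding gen_def by (blast dest: generic_imp_ex)
    moreover have "range (val g) \<subseteq> univ M" using e unfolding val_def by auto
    ultimately show "\<exists>s. range s \<subseteq> univ M \<and> (\<forall>\<psi>\<in>\<Sigma>0. sat M \<psi> s)" by blast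
  qed
  then obtain s where s: "range s \<subseteq> univ M" "\<And>\<psi>. \<psi> \<in> \<Sigma> \<Longrightarrow> sat M \<psi> s" by blast
  have sat_s: "sat M \<psi> s \<longleftrightarrow> gen n (\<lambda>g. sat M \<psi> (val g))" if n: "bound \<psi> n" for \<psi> n
  proof
    assume "sat M \<psi> s"
    then have "Neg \<psi> \<notin> \<Sigma>" using s(2) by fastforce
    moreover have "bound (Neg \<psi>) n" using n unfolding bound_def by simp
    ultimately show "gen n (\<lambda>g. sat M \<psi> (val g))"
      using \<Sigma>[of "Neg \<psi>" n] generic_not[of "full n []" False "[]" "\<lambda>g. sat M \<psi> (val g)"]
      unfolding gen_def by simp
  qed (use \<Sigma>[OF n] s(2) in blast)
  define c where "c \<mu> i = s (code \<mu> i)" for \<mu> i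
  \<comment> \<open>Two node assignments are treated at one common height, so that their generic
    truth values can be compared.\<close>
  have sat_c: "\<exists>n. n0 \<le> n \<and> (sat M \<psi> (\<lambda>m. c (\<mu> m) (i m)) \<longleftrightarrow> gen n (\<lambda>g. sat M \<psi> (\<lambda>m. e (g (\<mu> m)) (i m)))) \<and>
      (sat M \<psi> (\<lambda>m. c (\<mu>' m) (i m)) \<longleftrightarrow> gen n (\<lambda>g. sat M \<psi> (\<lambda>m. e (g (\<mu>' m)) (i m))))"
    for n0 \<psi> \<mu> \<mu>' i
  proof -
    have "\<forall>\<mu>. \<exists>\<psi>'. \<forall>s. sat M \<psi>' s \<longleftrightarrow> sat M \<psi> (\<lambda>m. s (code (\<mu> m) (i m)))"
      by (intro allI ex_rename)
    from choice[OF this] obtain f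
      where f: "\<And>\<mu> s. sat M (f \<mu>) s \<longleftrightarrow> sat M \<psi> (\<lambda>m. s (code (\<mu> m) (i m)))" by blast
    obtain n1 where n1: "bound (f \<mu>) n1" "n0 \<le> n1" using ex_bound by blast
    obtain n where n: "bound (f \<mu>') n" "n1 \<le> n" using ex_bound by blast
    have "bound (f \<mu>) n" using n1(1) n(2) by (rule bound_mono)
    then show ?thesis
      using sat_s[of "f \<mu>" n] sat_s[OF n(1)] n1(2) n(2) by (intro exI[of _ n]) (auto simp: f c_def val_def)
  qed
  show ?thesis
  proof (intro exI[of _ c] conjI allI impI)
    show "c \<mu> i \<in> univ M" for \<mu> i using s(1) unfolding c_def by auto
  next
    fix J :: "'j set" and x y :: "'j \<Rightarrow> bool list" and \<psi> :: "('f, 'r) fml" and j i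
    assume xy: "alpha_similar J x y" and j: "\<forall>m\<in>fv \<psi>. j m \<in> J"
    have "finite (length ` (x ` J \<union> y ` J))" using xy unfolding alpha_similar_def by blast
    then obtain n0 where n0: "\<forall>q\<in>length ` (x ` J \<union> y ` J). q < n0"
      using finite_nat_set_iff_bounded by blast
    obtain n where n: "n0 \<le> n"
      "sat M \<psi> (\<lambda>m. c (x (j m)) (i m)) \<longleftrightarrow> gen n (\<lambda>g. sat M \<psi> (\<lambda>m. e (g (x (j m))) (i m)))"
      "sat M \<psi> (\<lambda>m. c (y (j m)) (i m)) \<longleftrightarrow> gen n (\<lambda>g. sat M \<psi> (\<lambda>m. e (g (y (j m))) (i m)))"
      using sat_c[of n0 \<psi> "\<lambda>m. x (j m)" i "\<lambda>m. y (j m)"] by blast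
    have "gen n (\<lambda>g. sat M \<psi> (\<lambda>m. e (g (x (j m))) (i m))) \<longleftrightarrow> gen n (\<lambda>g. sat M \<psi> (\<lambda>m. e (g (y (j m))) (i m)))"
      unfolding gen_def
    proof (rule generic_similar[where F = "\<lambda>u. sat M \<psi> (\<lambda>m. e (u (j m)) (i m))" and J = J])
      show "sat M \<psi> (\<lambda>m. e (u (j m)) (i m)) = sat M \<psi> (\<lambda>m. e (v (j m)) (i m))"
        if "\<And>a. a \<in> J \<Longrightarrow> u a = v a" for u v
        by (rule sat_cong) (simp add: that j)
      show "length (x a) < n" "length (y a) < n" if "a \<in> J" for a
        using less_le_trans[OF bspec[OF n0] n(1)] that by auto
    qed (use xy in \<open>auto simp: alpha_similar_def\<close>)
    then show "sat M \<psi> (\<lambda>m. c (x (j m)) (i m)) \<longleftrightarrow> sat M \<psi> (\<lambda>m. c (y (j m)) (i m))"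
      using n by simp
  next
    fix X \<psi> \<mu> i
    assume X: "finite X" and *: "\<forall>g. branch_preserving_on X g \<longrightarrow> sat M \<psi> (\<lambda>m. e (g (\<mu> m)) (i m))"
    obtain n0 where n0: "\<forall>q\<in>length ` X. q < n0"
      using X finite_nat_set_iff_bounded by blast
    obtain n where n: "n0 \<le> n"
      "sat M \<psi> (\<lambda>m. c (\<mu> m) (i m)) \<longleftrightarrow> gen n (\<lambda>g. sat M \<psi> (\<lambda>m. e (g (\<mu> m)) (i m)))"
      using sat_c[of n0 \<psi> \<mu> i] by blast
    have Xn: "X \<subseteq> set_tree (full n [])" using less_le_trans[OF bspec[OF n0] n(1)] by (auto simp: set_full)
    have "gen n (\<lambda>g. sat M \<psi> (\<lambda>m. e (g (\<mu> m)) (i m)))"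
      unfolding gen_def
    proof (rule generic_if_placed)
      fix g assume "placed (full n []) False [] (\<lambda>_. []) g"
      from placed_full[OF this] have "branch_preserving_on X g"
        using Xn unfolding branch_preserving_on_def by blast
      then show "sat M \<psi> (\<lambda>m. e (g (\<mu> m)) (i m))" by (rule *[rule_format])
    qed
    then show "sat M \<psi> (\<lambda>m. c (\<mu> m) (i m))" using n by simp
  qed
qed

section \<open>Stretching the binary tree\<close>

fun stretch :: "bool list \<Rightarrow> bool list" where
  "stretch [] = []"
| "stretch (True # \<eta>) = True # stretch \<eta>"
| "stretch (False # \<eta>) = True # False # stretch \<eta>"

lemma stretch_neq_False_Cons [simp]: "stretch \<nu> \<noteq> False # \<eta>"
  by (cases \<nu> rule: stretch.cases) auto

lemma stretch_eq_Nil [simp]: "stretch \<eta> = [] \<longleftrightarrow> \<eta> = []"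
  by (cases \<eta> rule: stretch.cases) auto

lemma inj_stretch: "stretch \<eta> = stretch \<nu> \<Longrightarrow> \<eta> = \<nu>"
proof (induction \<eta> arbitrary: \<nu> rule: stretch.induct)
  case 1
  then show ?case by (metis stretch_eq_Nil stretch.simps(1))
next
  case (2 \<eta>)
  then show ?case by (cases \<nu> rule: stretch.cases) auto
next
  case (3 \<eta>)
  then show ?case by (cases \<nu> rule: stretch.cases) (auto dest: sym)
qed

text \<open>Both letter codes begin with 1, so a proper extension continues with 1; conversely, a 1
  after \<open>stretch \<eta>\<close> starts a new letter code.\<close>

lemma prefix_stretch_True: "prefix (stretch \<eta> @ [True]) (stretch \<nu>) \<longleftrightarrow> strict_prefix \<eta> \<nu>"
proof (induction \<eta> arbitrary: \<nu> rule: stretch.induct)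
  case 1
  then show ?case by (cases \<nu> rule: stretch.cases) auto
next
  case (2 \<eta>)
  then show ?case by (cases \<nu> rule: stretch.cases; cases \<eta> rule: stretch.cases) auto
next
  case (3 \<eta>)
  have "\<not> prefix (False # \<mu>) (stretch \<nu>)" for \<mu> \<nu>
    by (cases \<nu> rule: stretch.cases) auto
  with 3 show ?case by (cases \<nu> rule: stretch.cases) auto
qed

text \<open>A 0 occurs only as the second half of the code 10. So the last 1 of
  \<open>stretch \<eta>\<close> codes a final letter 1 of \<open>\<eta>\<close>, while in
  \<open>stretch \<nu>\<close> the same 1 opens the code of a 0.\<close>

lemma prefix_stretch_False:
  "prefix (stretch \<eta> @ [False]) (stretch \<nu>) \<longleftrightarrow> (\<exists>\<rho>. \<eta> = \<rho> @ [True] \<and> prefix (\<rho> @ [False]) \<nu>)"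
proof (induction \<eta> arbitrary: \<nu> rule: stretch.induct)
  case 1
  then show ?case by (cases \<nu> rule: stretch.cases) auto
next
  case (2 \<eta>)
  have step: "(\<exists>\<rho>. True # \<eta> = \<rho> @ [True] \<and> prefix (\<rho> @ [False]) \<nu>) \<longleftrightarrow>
      \<eta> = [] \<and> prefix [False] \<nu> \<or> (\<exists>\<rho>. \<eta> = \<rho> @ [True] \<and> prefix (True # \<rho> @ [False]) \<nu>)" for \<nu>
    by (auto simp: Cons_eq_append_conv)
  have "prefix (stretch \<eta> @ [False]) (False # \<mu>) \<longleftrightarrow> \<eta> = []" for \<mu>
    by (cases \<eta> rule: stretch.cases) auto
  then show ?case unfolding step using 2 by (cases \<nu> rule: stretch.cases) auto
next
  case (3 \<eta>)
  have step: "(\<exists>\<rho>. False # \<eta> = \<rho> @ [True] \<and> prefix (\<rho> @ [False]) \<nu>) \<longleftrightarrow>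
      (\<exists>\<rho>. \<eta> = \<rho> @ [True] \<and> prefix (False # \<rho> @ [False]) \<nu>)" for \<nu>
    by (auto simp: Cons_eq_append_conv)
  have "\<not> prefix (False # \<mu>) (stretch \<nu>)" for \<mu> \<nu>
    by (cases \<nu> rule: stretch.cases) auto
  then show ?case unfolding step using 3 by (cases \<nu> rule: stretch.cases) auto
qed

text \<open>Where two words split, their codes 1 and 10 still share the letter 1, which moves the
  meet one step up.\<close>

lemma longest_common_prefix_stretch:
  "longest_common_prefix (stretch \<eta>) (stretch \<nu>) =
    (if prefix \<eta> \<nu> \<or> prefix \<nu> \<eta> then stretch (longest_common_prefix \<eta> \<nu>)
     else stretch (longest_common_prefix \<eta> \<nu> @ [True]))"
proof (induction \<eta> arbitrary: \<nu> rule: stretch.induct)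
  case 1
  then show ?case by simp
next
  case (2 \<eta>)
  have "longest_common_prefix (stretch \<eta>) (False # \<mu>) = []" for \<mu>
    by (cases \<eta> rule: stretch.cases) auto
  with 2 show ?case by (cases \<nu> rule: stretch.cases) auto
next
  case (3 \<eta>)
  have "longest_common_prefix (False # \<mu>) (stretch \<nu>) = []" for \<mu> \<nu>
    by (cases \<nu> rule: stretch.cases) auto
  with 3 show ?case by (cases \<nu> rule: stretch.cases) auto
qed

section \<open>Meets of words, and similarity after stretching\<close>

lemma strict_prefix_snoc: "strict_prefix \<eta> (\<nu> @ [d]) \<longleftrightarrow> prefix \<eta> \<nu>"
  unfolding strict_prefix_def by (auto dest: prefix_length_le)

lemma longest_common_prefix_left: "prefix \<eta> \<nu> \<Longrightarrow> longest_common_prefix \<eta> \<nu> = \<eta>"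
  by (metis longest_common_prefix_max_prefix longest_common_prefix_prefix1 prefix_order.antisym prefix_order.refl)

lemma longest_common_prefix_commute: "longest_common_prefix \<eta> \<nu> = longest_common_prefix \<nu> \<eta>"
  by (induction \<eta> \<nu> rule: longest_common_prefix.induct) auto

lemma longest_common_prefix_snoc:
  "\<not> prefix (\<eta> @ [d]) \<nu> \<Longrightarrow> longest_common_prefix (\<eta> @ [d]) \<nu> = longest_common_prefix \<eta> \<nu>"
proof (induction \<eta> arbitrary: \<nu>)
  case Nil
  then show ?case by (cases \<nu>) auto
next
  case (Cons x \<eta>)
  then show ?case by (cases \<nu>) auto
qed

lemma longest_common_prefix_branch:
  "c \<noteq> d \<Longrightarrow> longest_common_prefix (\<rho> @ c # \<eta>) (\<rho> @ d # \<nu>) = \<rho>"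
  by (induction \<rho>) auto

text \<open>Branches that split at \<open>\<eta>\<close> meet in \<open>stretch (\<eta> @ [True])\<close> after
  stretching, so meet closure requires listing every entry together with its 1-successor. Clause
  (iv) of the relation is what decides when such an added node is already an entry.\<close>
lemma approx_beta_alpha_similar:
  assumes "approx_beta n \<eta> \<nu>"
  defines "E \<equiv> \<lambda>\<eta> (a :: nat \<times> bool). if snd a then \<eta> (fst a) @ [True] else \<eta> (fst a)"
  shows "alpha_similar ({..n} \<times> UNIV) (\<lambda>a. stretch (E \<eta> a)) (\<lambda>a. stretch (E \<nu> a))"
proof -
  let ?J = "{..n} \<times> (UNIV :: bool set)"
  have closed: "meet_closed n \<eta>" "meet_closed n \<nu>" using assms(1) unfolding approx_beta_def by auto
  have pre: "prefix (\<eta> i) (\<eta> j) \<longleftrightarrow> prefix (\<nu> i) (\<nu> j)"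
    and preS: "prefix (\<eta> i @ [d]) (\<eta> j) \<longleftrightarrow> prefix (\<nu> i @ [d]) (\<nu> j)"
    and eqS: "\<eta> i @ [True] = \<eta> j \<longleftrightarrow> \<nu> i @ [True] = \<nu> j" if "i \<le> n" "j \<le> n" for i j d
    using assms(1) that unfolding approx_beta_def by auto
  have eq: "\<eta> i = \<eta> j \<longleftrightarrow> \<nu> i = \<nu> j" if "i \<le> n" "j \<le> n" for i j
    using pre[OF that] pre[OF that(2,1)] by (auto simp: prefix_order.eq_iff)
  have E_eq: "E \<eta> a = E \<eta> b \<longleftrightarrow> E \<nu> a = E \<nu> b" if "a \<in> ?J" "b \<in> ?J" for a b
  proof -
    obtain i p j q where ab: "a = (i, p)" "b = (j, q)" by fastforce
    then have ij: "i \<le> n" "j \<le> n" using that by auto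
    show ?thesis
      unfolding ab E_def fst_conv snd_conv
      using eq[OF ij] eqS[OF ij] eqS[OF ij(2,1)]
      by (cases p; cases q; simp only: if_True if_False append_same_eq; metis)
  qed
  have E_strict: "strict_prefix (E \<eta> a) (E \<eta> b) \<longleftrightarrow> strict_prefix (E \<nu> a) (E \<nu> b)"
    if "a \<in> ?J" "b \<in> ?J" for a b
  proof -
    obtain i p j q where ab: "a = (i, p)" "b = (j, q)" by fastforce
    then have ij: "i \<le> n" "j \<le> n" using that by auto
    show ?thesis
    proof (cases q)
      case True
      then show ?thesis using pre[OF ij] preS[OF ij] unfolding ab E_def by (simp add: strict_prefix_snoc)
    next
      case False
      then show ?thesis
        using pre[OF ij] preS[OF ij] eq[OF ij] eqS[OF ij] unfolding ab E_def strict_prefix_def by simp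
    qed
  qed
  \<comment> \<open>For an added node, \<open>\<rho>\<close> is the entry \<open>\<xi> i\<close>.
    For an original entry, \<open>\<rho>\<close> is the meet of \<open>\<xi> i\<close> and
    \<open>\<xi> j\<close>, hence an entry by meet closure. Either way the condition is expressed by
    clauses (iii) and (iv).\<close>
  have turn: "(\<exists>\<rho>. E \<xi> (i, p) = \<rho> @ [True] \<and> prefix (\<rho> @ [False]) (E \<xi> (j, q))) \<longleftrightarrow>
      (if p then prefix (\<xi> i @ [False]) (\<xi> j)
       else \<exists>m\<le>n. \<xi> m @ [True] = \<xi> i \<and> prefix (\<xi> m @ [False]) (\<xi> j))"
    if \<xi>: "meet_closed n \<xi>" and ij: "i \<le> n" "j \<le> n" for \<xi> i p j q
  proof -
    have last: "prefix (\<rho> @ [False]) (E \<xi> (j, q)) \<longleftrightarrow> prefix (\<rho> @ [False]) (\<xi> j)" for \<rho>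
      unfolding E_def by simp
    have "\<exists>m\<le>n. \<xi> m = \<rho>" if \<rho>: "\<xi> i = \<rho> @ [True]" "prefix (\<rho> @ [False]) (\<xi> j)" for \<rho>
    proof -
      obtain \<sigma> where "\<xi> j = \<rho> @ False # \<sigma>" using \<rho>(2) by (auto simp: prefix_def)
      then have "longest_common_prefix (\<xi> i) (\<xi> j) = \<rho>"
        using \<rho>(1) longest_common_prefix_branch[of True False \<rho> "[]"] by simp
      then show ?thesis using \<xi> ij unfolding meet_closed_def by metis
    qed
    then show ?thesis unfolding last unfolding E_def by (cases p) (auto, metis)
  qed
  have E_turn: "(\<exists>\<rho>. E \<eta> a = \<rho> @ [True] \<and> prefix (\<rho> @ [False]) (E \<eta> b)) \<longleftrightarrow>
      (\<exists>\<rho>. E \<nu> a = \<rho> @ [True] \<and> prefix (\<rho> @ [False]) (E \<nu> b))"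
    if "a \<in> ?J" "b \<in> ?J" for a b
  proof -
    obtain i p j q where ab: "a = (i, p)" "b = (j, q)" by fastforce
    then have ij: "i \<le> n" "j \<le> n" using that by auto
    show ?thesis
      unfolding ab turn[OF closed(1) ij] turn[OF closed(2) ij]
      using preS[OF ij] eqS[OF _ ij(1)] preS[OF _ ij(2)] by auto
  qed
  have meet: "longest_common_prefix (stretch (E \<eta> a)) (stretch (E \<eta> b)) \<in> (\<lambda>a. stretch (E \<eta> a)) ` ?J"
    if ab: "a \<in> ?J" "b \<in> ?J" for a b
  proof -
    consider "prefix (E \<eta> a) (E \<eta> b)" | "prefix (E \<eta> b) (E \<eta> a)"
      | "\<not> prefix (E \<eta> a) (E \<eta> b)" "\<not> prefix (E \<eta> b) (E \<eta> a)" by blast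
    then show ?thesis
    proof cases
      case 1
      then show ?thesis
        using ab by (simp add: longest_common_prefix_stretch longest_common_prefix_left)
    next
      case 2
      then show ?thesis
        using ab by (simp add: longest_common_prefix_stretch longest_common_prefix_left
            longest_common_prefix_commute[of "E \<eta> a"])
    next
      case 3
      obtain i p j q where ab': "a = (i, p)" "b = (j, q)" by fastforce
      \<comment> \<open>For incomparable nodes an appended final 1 does not affect the meet, which
        is thus a meet of original entries.\<close>
      have "longest_common_prefix (E \<eta> a) (E \<eta> b) = longest_common_prefix (\<eta> i) (E \<eta> b)"
        using 3(1) longest_common_prefix_snoc[of "\<eta> i" True "E \<eta> b"] unfolding ab' E_def by (cases p) auto
      also have "\<dots> = longest_common_prefix (\<eta> i) (\<eta> j)"
      proof (cases q)
        case True
        have "prefix (\<eta> i) (E \<eta> a)" unfolding ab' E_def by simp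
        then have "\<not> prefix (\<eta> j @ [True]) (\<eta> i)"
          using 3(2) True prefix_order.trans unfolding ab' E_def by fastforce
        then show ?thesis
          using True longest_common_prefix_snoc[of "\<eta> j" True "\<eta> i"]
          unfolding ab' E_def by (simp add: longest_common_prefix_commute[of "\<eta> i"])
      qed (simp add: ab' E_def)
      finally obtain m where "m \<le> n" "longest_common_prefix (E \<eta> a) (E \<eta> b) = \<eta> m"
        using closed(1) ab unfolding meet_closed_def ab' by auto
      then show ?thesis
        using 3 unfolding longest_common_prefix_stretch
        by (intro image_eqI[of _ _ "(m, True)"]) (auto simp: E_def)
    qed
  qed
  have step: "prefix (stretch (E \<eta> a) @ [c]) (stretch (E \<eta> b)) \<longleftrightarrow> prefix (stretch (E \<nu> a) @ [c]) (stretch (E \<nu> b))"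
    if "a \<in> ?J" "b \<in> ?J" for a b c
    using E_strict[OF that] E_turn[OF that] by (cases c) (simp_all add: prefix_stretch_True prefix_stretch_False)
  have same: "stretch (E \<eta> a) = stretch (E \<eta> b) \<longleftrightarrow> stretch (E \<nu> a) = stretch (E \<nu> b)"
    if "a \<in> ?J" "b \<in> ?J" for a b
    using E_eq[OF that] inj_stretch by metis
  show ?thesis
    unfolding alpha_similar_def
  proof (intro conjI ballI allI impI)
    show "finite ?J" by simp
  next
    fix a b assume ab: "a \<in> ?J" "b \<in> ?J"
    show "longest_common_prefix (stretch (E \<eta> a)) (stretch (E \<eta> b)) \<in> (\<lambda>a. stretch (E \<eta> a)) ` ?J"
      using ab by (rule meet)
    show "stretch (E \<eta> a) = stretch (E \<eta> b) \<longleftrightarrow> stretch (E \<nu> a) = stretch (E \<nu> b)"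
      using ab by (rule same)
    show "prefix (stretch (E \<nu> a) @ [c]) (stretch (E \<nu> b))"
      if "prefix (stretch (E \<eta> a) @ [c]) (stretch (E \<eta> b))" for c
      using that step[OF ab] by blast
  qed
qed

section \<open>Branches and the final construction\<close>

lemma restr_prefix: "m \<le> n \<Longrightarrow> prefix (restr \<eta> m) (restr \<eta> n)"
  unfolding restr_def by (metis le_Suc_ex map_append prefixI upt_add_eq_append zero_le)

lemma length_restr [simp]: "length (restr \<eta> n) = n"
  by (simp add: restr_def)

text \<open>Continues the finite word \<open>\<omega>\<close> by zeros to an infinite branch, to
  which consistency along branches applies.\<close>

lemma restr_nth: "prefix \<nu> \<omega> \<Longrightarrow> restr (\<lambda>i. i < length \<omega> \<and> \<omega> ! i) (length \<nu>) = \<nu>"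
  by (rule nth_equalityI) (auto simp: restr_def prefix_def nth_append)

lemma consistent_in_finite:
  "finite \<Gamma> \<Longrightarrow> consistent_in M k \<Gamma> \<longleftrightarrow>
    (\<exists>b. (\<forall>i<k. b i \<in> univ M) \<and> (\<forall>(\<psi>, a)\<in>\<Gamma>. sat M \<psi> (asg k b a)))"
  unfolding consistent_in_def by blast

theorem theorem3p8:
  fixes T :: "('f, 'r) fml set" and M :: "('a, 'f, 'r) struct"
    and \<phi> :: "('f, 'r) fml" and k l :: nat
  assumes "complete_theory T"
    and "is_model M T"
    and "aleph1_saturated M"
    and "fv \<phi> \<subseteq> {..<k + l}"
    and "\<exists>a. witnesses_SOP1 M k l \<phi> a"
  shows "\<exists>e. beta_indiscernible M l e \<and> witnesses_SOP1 M k l \<phi> e"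
proof -
  obtain a where tree: "\<And>\<eta> i. i < l \<Longrightarrow> a \<eta> i \<in> univ M"
    and path: "\<And>\<eta>. consistent_in M k {(\<phi>, a (restr \<eta> n)) | n. True}"
    and incons: "\<And>\<eta> \<nu>. \<not> consistent_in M k {(\<phi>, a (\<eta> @ [True])), (\<phi>, a (\<eta> @ [False] @ \<nu>))}"
    using assms(5) unfolding witnesses_SOP1_def tree_in_def by blast
  have M: "is_struct M" using assms(2) unfolding is_model_def by blast
  then obtain u where u: "u \<in> univ M" unfolding is_struct_def by blast
  \<comment> \<open>\<open>u\<close> fills the coordinates from \<open>l\<close> on, so that all
    coordinates lie in the universe as the construction of \<open>c\<close> requires.\<close>
  define d where "d \<mu> i = (if i < l then a (\<mu> @ [True]) i else u)" for \<mu> i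
  have d: "d \<mu> i \<in> univ M" for \<mu> i using tree u unfolding d_def by auto
  obtain p :: "bool \<Rightarrow> (bool list \<Rightarrow> bool) \<Rightarrow> bool" where "absorbing_ultrafilters p"
    using ex_absorbing_ultrafilters[where 'a = bool] unfolding absorbing_ultrafilters_def by blast
  then interpret absorbing_ultrafilters p .
  obtain c where c: "\<forall>\<mu> i. c \<mu> i \<in> univ M"
    and indisc: "\<forall>(J :: (nat \<times> bool) set) x y (\<psi> :: ('f, 'r) fml) j i.
      alpha_similar J x y \<longrightarrow> (\<forall>m\<in>fv \<psi>. j m \<in> J) \<longrightarrow>
      (sat M \<psi> (\<lambda>m. c (x (j m)) (i m)) \<longleftrightarrow> sat M \<psi> (\<lambda>m. c (y (j m)) (i m)))"
    and based: "\<forall>X (\<psi> :: ('f, 'r) fml) \<mu> i. finite X \<longrightarrow>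
      (\<forall>g. branch_preserving_on X g \<longrightarrow> sat M \<psi> (\<lambda>m. d (g (\<mu> m)) (i m))) \<longrightarrow>
      sat M \<psi> (\<lambda>m. c (\<mu> m) (i m))"
    using ex_alpha_indiscernible[where 'j = "nat \<times> bool" and e = d, OF assms(3) M d]
    by (elim exE conjE)
  define e where "e \<eta> = c (stretch \<eta>)" for \<eta>
  have "same_type M l n e \<eta> \<nu>" if "approx_beta n \<eta> \<nu>" for n \<eta> \<nu>
    unfolding same_type_def
  proof (intro allI impI)
    fix \<psi> :: "('f, 'r) fml" assume \<psi>: "fv \<psi> \<subseteq> {..<Suc n * l}"
    \<comment> \<open>The flag \<open>False\<close> selects the entry itself rather than its added
      1-successor.\<close>
    have "(m div l, False) \<in> {..n} \<times> UNIV" if "m \<in> fv \<psi>" for m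
      using less_mult_imp_div_less[of m "Suc n" l] \<psi> that by auto
    from indisc[rule_format, OF approx_beta_alpha_similar[OF that], of \<psi> "\<lambda>m. (m div l, False)" "\<lambda>m. m mod l", OF this]
    show "sat M \<psi> (\<lambda>m. e (\<eta> (m div l)) (m mod l)) \<longleftrightarrow> sat M \<psi> (\<lambda>m. e (\<nu> (m div l)) (m mod l))"
      by (simp add: e_def)
  qed
  then have "beta_indiscernible M l e" unfolding beta_indiscernible_def by blast
  define solvable where
    "solvable t F \<longleftrightarrow> (\<exists>b. (\<forall>i<k. b i \<in> univ M) \<and> (\<forall>\<mu>\<in>F. sat M \<phi> (asg k b (t \<mu>))))"
    for t :: "bool list \<Rightarrow> nat \<Rightarrow> 'a" and F
  \<comment> \<open>A truth value of solvability shared by all branch-preserving copies of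
    \<open>d\<close> passes to \<open>c\<close>: \<open>based\<close> is applied to the consistency
    formula or to its negation.\<close>
  have solvable_c: "solvable c F \<longleftrightarrow> v"
    if F: "finite F" and v: "\<And>g. branch_preserving_on F g \<Longrightarrow> solvable (\<lambda>\<mu>. d (g \<mu>)) F \<longleftrightarrow> v" for F v
  proof -
    define node :: "nat \<Rightarrow> bool list" where "node m = fst (from_nat m :: bool list \<times> nat)" for m
    define coord :: "nat \<Rightarrow> nat" where "coord m = snd (from_nat m :: bool list \<times> nat)" for m
    obtain \<chi> where \<chi>: "\<And>s. sat M \<chi> s \<longleftrightarrow>
      (\<exists>b. (\<forall>i<k. b i \<in> univ M) \<and> (\<forall>\<mu>\<in>F. sat M \<phi> (asg k b (\<lambda>i. s (to_nat (\<mu>, i))))))"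
      using ex_consistency_formula[OF F assms(4), of M "\<lambda>\<mu> i. to_nat (\<mu>, i)"] by blast
    have sat_\<chi>: "sat M \<chi> (\<lambda>m. t (node m) (coord m)) \<longleftrightarrow> solvable t F" for t
      unfolding \<chi> solvable_def node_def coord_def by simp
    show ?thesis
    proof (cases v)
      case True
      have "sat M \<chi> (\<lambda>m. c (node m) (coord m))"
        by (rule based[rule_format, OF F]) (use sat_\<chi>[of "\<lambda>\<mu>. d (g \<mu>)" for g] v True in simp)
      then show ?thesis using sat_\<chi> True by simp
    next
      case False
      have "sat M (Neg \<chi>) (\<lambda>m. c (node m) (coord m))"
        by (rule based[rule_format, OF F]) (use sat_\<chi>[of "\<lambda>\<mu>. d (g \<mu>)" for g] v False in simp)
      then show ?thesis using sat_\<chi> False by simp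
    qed
  qed
  have sat_d: "sat M \<phi> (asg k b (d \<mu>)) \<longleftrightarrow> sat M \<phi> (asg k b (a (\<mu> @ [True])))" for b \<mu>
    by (rule sat_cong) (use assms(4) in \<open>auto simp: asg_def d_def\<close>)
  have path_e: "consistent_in M k {(\<phi>, e (restr \<eta> n)) | n. True}" for \<eta>
    unfolding consistent_in_def
  proof (intro allI impI, elim conjE)
    fix \<Gamma>0 assume \<Gamma>0: "finite \<Gamma>0" "\<Gamma>0 \<subseteq> {(\<phi>, e (restr \<eta> n)) | n. True}"
    then have "\<Gamma>0 \<subseteq> (\<lambda>n. (\<phi>, e (restr \<eta> n))) ` UNIV" by auto
    from finite_subset_image[OF \<Gamma>0(1) this] obtain D where D: "finite D" "\<Gamma>0 = (\<lambda>n. (\<phi>, e (restr \<eta> n))) ` D"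
      by blast
    then obtain N where N: "\<forall>m\<in>D. m < N" using finite_nat_set_iff_bounded by blast
    define F where "F = (\<lambda>m. stretch (restr \<eta> m)) ` {..N}"
    have "solvable c F \<longleftrightarrow> True"
    proof (rule solvable_c)
      fix g assume g: "branch_preserving_on F g"
      \<comment> \<open>The final 1 is appended because \<open>d\<close> at the top node is
        \<open>a\<close> at its 1-successor, which must also lie on the branch.\<close>
      define \<omega> where "\<omega> = g (stretch (restr \<eta> N)) @ [True]"
      have "prefix (g \<mu> @ [True]) \<omega>" if \<mu>: "\<mu> \<in> F" for \<mu>
      proof -
        obtain m where m: "m \<le> N" "\<mu> = stretch (restr \<eta> m)" using \<mu> unfolding F_def by auto
        show ?thesis
        proof (cases "m = N")
          case False
          then have "strict_prefix (restr \<eta> m) (restr \<eta> N)"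
            using m(1) restr_prefix[of m N \<eta>] by (metis length_restr strict_prefixI)
          then have "prefix (\<mu> @ [True]) (stretch (restr \<eta> N))"
            unfolding m(2) by (simp only: prefix_stretch_True)
          moreover have "stretch (restr \<eta> N) \<in> F" unfolding F_def by blast
          ultimately have "prefix (g \<mu> @ [True]) (g (stretch (restr \<eta> N)))"
            using g \<mu> unfolding branch_preserving_on_def by blast
          then show ?thesis unfolding \<omega>_def by simp
        qed (simp add: \<omega>_def m)
      qed
      then have on_path: "restr (\<lambda>i. i < length \<omega> \<and> \<omega> ! i) (length (g \<mu> @ [True])) = g \<mu> @ [True]" if "\<mu> \<in> F" for \<mu>
        using that restr_nth by blast
      let ?G = "(\<lambda>\<mu>. (\<phi>, a (g \<mu> @ [True]))) ` F"
      have "?G \<subseteq> {(\<phi>, a (restr (\<lambda>i. i < length \<omega> \<and> \<omega> ! i) n)) | n. True}"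
      proof (rule image_subsetI)
        fix \<mu> assume "\<mu> \<in> F"
        from on_path[OF this]
        show "(\<phi>, a (g \<mu> @ [True])) \<in> {(\<phi>, a (restr (\<lambda>i. i < length \<omega> \<and> \<omega> ! i) n)) | n. True}"
          by (intro CollectI exI[of _ "length (g \<mu> @ [True])"]) (simp only: simp_thms)
      qed
      moreover have "finite ?G" unfolding F_def by simp
      ultimately have "\<exists>b. (\<forall>i<k. b i \<in> univ M) \<and> (\<forall>(\<psi>, a)\<in>?G. sat M \<psi> (asg k b a))"
        by (intro path[of "\<lambda>i. i < length \<omega> \<and> \<omega> ! i", unfolded consistent_in_def, THEN spec, THEN mp] conjI)
      then obtain b where "\<forall>i<k. b i \<in> univ M" "\<forall>(\<psi>, a)\<in>?G. sat M \<psi> (asg k b a)" by blast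
      then show "solvable (\<lambda>\<mu>. d (g \<mu>)) F \<longleftrightarrow> True" unfolding solvable_def sat_d by auto
    qed (simp add: F_def)
    then obtain b where b: "\<forall>i<k. b i \<in> univ M" "\<forall>\<mu>\<in>F. sat M \<phi> (asg k b (c \<mu>))" unfolding solvable_def by blast
    have "\<forall>(\<psi>, a)\<in>\<Gamma>0. sat M \<psi> (asg k b a)"
      using b(2) N unfolding D(2) F_def e_def by auto
    then show "\<exists>b. (\<forall>i<k. b i \<in> univ M) \<and> (\<forall>(\<psi>, a)\<in>\<Gamma>0. sat M \<psi> (asg k b a))" using b(1) by blast
  qed
  have incons_e: "\<not> consistent_in M k {(\<phi>, e (\<eta> @ [True])), (\<phi>, e (\<eta> @ [False] @ \<nu>))}" for \<eta> \<nu>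
  proof -
    let ?x = "stretch (\<eta> @ [True])" and ?y = "stretch (\<eta> @ [False] @ \<nu>)"
    have "solvable c {?x, ?y} \<longleftrightarrow> False"
    proof (rule solvable_c)
      fix g assume g: "branch_preserving_on {?x, ?y} g"
      have "prefix (?x @ [False]) ?y" unfolding prefix_stretch_False by auto
      then obtain \<sigma> where \<sigma>: "g ?y = g ?x @ [False] @ \<sigma>"
        using g unfolding branch_preserving_on_def by (auto simp: prefix_def)
      show "solvable (\<lambda>\<mu>. d (g \<mu>)) {?x, ?y} \<longleftrightarrow> False"
        \<comment> \<open>\<open>d\<close> at \<open>g ?y\<close> is \<open>a\<close> one step
          above, at \<open>g ?x @ [False] @ \<sigma> @ [True]\<close>.\<close>
        using incons[of "g ?x" "\<sigma> @ [True]"]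
        unfolding solvable_def sat_d by (simp add: consistent_in_finite \<sigma>[simplified])
    qed simp
    then show ?thesis unfolding solvable_def by (simp add: consistent_in_finite e_def)
  qed
  have "witnesses_SOP1 M k l \<phi> e"
    unfolding witnesses_SOP1_def tree_in_def using c path_e incons_e by (auto simp: e_def)
  then show ?thesis using \<open>beta_indiscernible M l e\<close> by blast
qed

end
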